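(* Let $(\Gamma,\mathcal G)$ be an elliptically regular boundary pair associated with a closed, non-negative, densely defined quadratic form $\mathfrak h$ in a Hilbert space $\mathcal H$, with Neumann operator $H$, Dirichlet operator $H^D$, extended Dirichlet solution operators $\overline S(z)\colon\mathcal G\to\mathcal H$ and Dirichlet-to-Neumann operators $\Lambda(z)$. Let $z\in\mathbb C\setminus(\sigma(H^D)\cup\sigma(H))$. Then $\Lambda(z)$ has a bounded inverse $\Lambda(z)^{-1}\colon\mathcal G\to\mathcal G$, and $$(H-z)^{-1}-(H^D-z)^{-1}=\overline S(z)\,\Lambda(z)^{-1}\,\overline S(\overline z)^*$$ as bounded operators on $\mathcal H$. As a consequence, for every $\lambda\notin\sigma(H^D)$, $$\lambda\in\sigma(H)\iff 0\in\sigma(\Lambda(\lambda)).$$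
   Context: All Hilbert spaces are complex; inner products and sesquilinear forms are linear in the first argument. Let $\mathfrak h$ be a closed, non-negative, densely defined quadratic form in a Hilbert space $\mathcal H$ (the same symbol denotes its sesquilinear form), with domain $\mathcal H^1:=\operatorname{dom}\mathfrak h$, a Hilbert space with norm $\|u\|_{\mathcal H^1}^2=\mathfrak h(u)+\|u\|_{\mathcal H}^2$. A boundary pair associated with $\mathfrak h$ is a pair $(\Gamma,\mathcal G)$ of a Hilbert space $\mathcal G$ and a bounded operator $\Gamma\colon\mathcal H^1\to\mathcal G$ such that $\mathcal H^{1,D}:=\ker\Gamma$ is dense in $\mathcal H$ and $\mathcal G^{1/2}:=\operatorname{ran}\Gamma$ is dense in $\mathcal G$. The Neumann operator $H$ is the self-adjoint operator associated with $\mathfrak h$; the Dirichlet operator $H^D$ is the self-adjoint operator associated with the closed form $\mathfrak h|_{\mathcal H^{1,D}}$. For $z\in\mathbb C$ let $\mathcal N^1(z):=\{h\in\mathcal H^1: \mathfrak h(h,f)=z\langle h,f\rangle_{\mathcal H}\ \forall f\in\mathcal H^{1,D}\}$. For $z\notin\sigma(H^D)$, $\Gamma$ restricts to a bijection $\mathcal N^1(z)\to\mathcal G^{1/2}$, and the Dirichlet solution operator is its inverse $S(z)\colon\mathcal G^{1/2}\to\mathcal N^1(z)\subset\mathcal H^1$. The Dirichlet-to-Neumann form is $\mathfrak l_z(\phi,\psi):=\mathfrak h(S(z)\phi,S(-1)\psi)-z\langle S(z)\phi,S(-1)\psi\rangle_{\mathcal H}$ for $\phi,\psi\in\mathcal G^{1/2}$.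 The Dirichlet-to-Neumann operator $\Lambda(z)$ is the associated operator in $\mathcal G$: $\phi\in\operatorname{dom}\Lambda(z)$ and $\Lambda(z)\phi=\eta$ iff $\phi\in\mathcal G^{1/2}$, $\eta\in\mathcal G$ and $\mathfrak l_z(\phi,\psi)=\langle\eta,\psi\rangle_{\mathcal G}$ for all $\psi\in\mathcal G^{1/2}$. The boundary pair is elliptically regular if there is $c>0$ with $\|S(-1)\phi\|_{\mathcal H}\le c\|\phi\|_{\mathcal G}$ for all $\phi\in\mathcal G^{1/2}$. In this case each $S(z)$, $z\notin\sigma(H^D)$, extends uniquely to a bounded operator $\overline S(z)\colon\mathcal G\to\mathcal H$; $\overline S(\overline z)^*\colon\mathcal H\to\mathcal G$ is the Hilbert space adjoint of $\overline S(\overline z)$. *)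

theory Defs
  imports "HOL-Analysis.Analysis"
begin

section \<open>Complex Hilbert spaces\<close>

text \<open>The library only has real inner product spaces. The inner product is linear in the first
  argument; the last axiom of the class \<open>complex_inner\<close> says that it is positive definite and
  induces the norm.\<close>

class scaleC =
  fixes scaleC :: "complex \<Rightarrow> 'a \<Rightarrow> 'a" (infixr "*\<^sub>C" 75)

class complex_inner = real_normed_vector + scaleC +
  fixes cinner :: "'a \<Rightarrow> 'a \<Rightarrow> complex"
  assumes scaleC_add_right: "a *\<^sub>C (x + y) = a *\<^sub>C x + a *\<^sub>C y"
    and scaleC_add_left: "(a + b) *\<^sub>C x = a *\<^sub>C x + b *\<^sub>C x"
    and scaleC_scaleC: "a *\<^sub>C (b *\<^sub>C x) = (a * b) *\<^sub>C x"
    and scaleR_scaleC: "r *\<^sub>R x = complex_of_real r *\<^sub>C x"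
    and cinner_add_left: "cinner (x + y) w = cinner x w + cinner y w"
    and cinner_scaleC_left: "cinner (a *\<^sub>C x) y = a * cinner x y"
    and cinner_commute: "cinner x y = cnj (cinner y x)"
    and cinner_self: "cinner x x = complex_of_real ((norm x)\<^sup>2)"

class chilbert_space = complex_inner + complete_space

instantiation complex :: chilbert_space
begin

definition scaleC_complex :: "complex \<Rightarrow> complex \<Rightarrow> complex"
  where "scaleC_complex a x = a * x"

definition cinner_complex :: "complex \<Rightarrow> complex \<Rightarrow> complex"
  where "cinner_complex x y = x * cnj y"

instance
proof
  fix a b x y w :: complex and r :: real
  show "a *\<^sub>C (x + y) = a *\<^sub>C x + a *\<^sub>C y"
    by (simp add: scaleC_complex_def distrib_left)
  show "(a + b) *\<^sub>C x = a *\<^sub>C x + b *\<^sub>C x"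
    by (simp add: scaleC_complex_def distrib_right)
  show "a *\<^sub>C (b *\<^sub>C x) = (a * b) *\<^sub>C x"
    by (simp add: scaleC_complex_def)
  show "r *\<^sub>R x = complex_of_real r *\<^sub>C x"
    by (simp add: scaleC_complex_def scaleR_conv_of_real)
  show "cinner (x + y) w = cinner x w + cinner y w"
    by (simp add: cinner_complex_def distrib_right)
  show "cinner (a *\<^sub>C x) y = a * cinner x y"
    by (simp add: cinner_complex_def scaleC_complex_def)
  show "cinner x y = cnj (cinner y x)"
    by (simp add: cinner_complex_def)
  show "cinner x x = complex_of_real ((norm x)\<^sup>2)"
    unfolding cinner_complex_def by (rule complex_norm_square[symmetric])
qed

end

definition csubspace :: "'a::complex_inner set \<Rightarrow> bool"
  where "csubspace D \<longleftrightarrow>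
    0 \<in> D \<and> (\<forall>u\<in>D. \<forall>v\<in>D. u + v \<in> D) \<and> (\<forall>a. \<forall>u\<in>D. a *\<^sub>C u \<in> D)"

definition bounded_clinear :: "('a::complex_inner \<Rightarrow> 'b::complex_inner) \<Rightarrow> bool"
  where "bounded_clinear T \<longleftrightarrow> bounded_linear T \<and> (\<forall>a x. T (a *\<^sub>C x) = a *\<^sub>C T x)"

definition cadjoint :: "('a::complex_inner \<Rightarrow> 'b::complex_inner) \<Rightarrow> 'b \<Rightarrow> 'a"
  where "cadjoint T = (THE T'. \<forall>x y. cinner (T x) y = cinner x (T' y))"


section \<open>Unbounded operators, represented by their graphs\<close>

type_synonym ('a, 'b) op_graph = "('a \<times> 'b) set"

definition op_inv :: "('a, 'b) op_graph \<Rightarrow> 'b \<Rightarrow> 'a"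
  where "op_inv A f = (THE u. (u, f) \<in> A)"

text \<open>\<open>A\<close> maps its domain bijectively onto the whole space, with bounded inverse.\<close>

definition boundedly_invertible :: "('a::complex_inner, 'b::complex_inner) op_graph \<Rightarrow> bool"
  where "boundedly_invertible A \<longleftrightarrow> (\<forall>f. \<exists>!u. (u, f) \<in> A) \<and> bounded_clinear (op_inv A)"

definition op_shift :: "('a::complex_inner, 'a) op_graph \<Rightarrow> complex \<Rightarrow> ('a, 'a) op_graph"
  where "op_shift A z = {(u, f - z *\<^sub>C u) | u f. (u, f) \<in> A}"

definition spectrum :: "('a::complex_inner, 'a) op_graph \<Rightarrow> complex set"
  where "spectrum A = {z. \<not> boundedly_invertible (op_shift A z)}"

definition resolvent :: "('a::complex_inner, 'a) op_graph \<Rightarrow> complex \<Rightarrow> 'a \<Rightarrow> 'a"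
  where "resolvent A z = op_inv (op_shift A z)"

text \<open>The operator associated with a sesquilinear form \<open>q\<close> with domain \<open>D\<close>. It is single-valued
  when \<open>D\<close> is dense. Here and below a form (and likewise the boundary operator) is a total
  function whose values outside its domain play no role.\<close>

definition form_op :: "'a::complex_inner set \<Rightarrow> ('a \<Rightarrow> 'a \<Rightarrow> complex) \<Rightarrow> ('a, 'a) op_graph"
  where "form_op D q = {(u, f). u \<in> D \<and> (\<forall>v\<in>D. q u v = cinner f v)}"

lemma cinner_diff_left:
  fixes x y w :: "'a::complex_inner"
  shows "cinner (x - y) w = cinner x w - cinner y w"
  using cinner_add_left[of "x - y" y w] by simp

lemma cinner_diff_right:
  fixes x y w :: "'a::complex_inner"
  shows "cinner w (x - y) = cinner w x - cinner w y"
  by (simp only: cinner_commute[of w] cinner_diff_left complex_cnj_diff)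

lemma cinner_dense_eq_0:
  fixes w :: "'a::complex_inner"
  assumes "closure D = UNIV" and orth: "\<And>v. v \<in> D \<Longrightarrow> cinner w v = 0"
  shows "w = 0"
proof -
  have "norm w \<le> 0"
  proof (rule field_le_epsilon)
    fix e :: real
    assume "0 < e"
    have "w \<in> closure D"
      using assms(1) by simp
    then obtain v where v: "v \<in> D" "dist v w < e"
      using \<open>0 < e\<close> unfolding closure_approachable by blast
    have wv: "cinner w v = 0" "cinner v w = 0"
      using orth[OF v(1)] cinner_commute[of v w] by simp_all
    have "cinner (w - v) (w - v) = cinner w w + cinner v v"
      by (simp add: cinner_diff_left cinner_diff_right wv)
    then have "complex_of_real ((norm (w - v))\<^sup>2) = complex_of_real ((norm w)\<^sup>2 + (norm v)\<^sup>2)"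
      by (simp only: cinner_self of_real_add)
    then have "(norm (w - v))\<^sup>2 = (norm w)\<^sup>2 + (norm v)\<^sup>2"
      using of_real_eq_iff by blast
    then have "(norm w)\<^sup>2 \<le> (norm (w - v))\<^sup>2"
      using zero_le_power2[of "norm v"] by linarith
    then have "norm w \<le> norm (w - v)"
      by (rule power2_le_imp_le) (rule norm_ge_zero)
    then show "norm w \<le> 0 + e"
      using v(2) by (simp add: dist_norm norm_minus_commute)
  qed
  then show ?thesis by simp
qed

lemma single_valued_form_op:
  assumes "closure D = UNIV"
  shows "single_valued (form_op D q)"
proof (rule single_valuedI)
  fix u f g
  assume "(u, f) \<in> form_op D q" "(u, g) \<in> form_op D q"
  then have "cinner (f - g) v = 0" if "v \<in> D" for v
    using that by (simp add: form_op_def cinner_diff_left)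
  then show "f = g"
    using cinner_dense_eq_0[OF assms, of "f - g"] by simp
qed


section \<open>Closed forms and boundary pairs\<close>

definition form_norm :: "('h::complex_inner \<Rightarrow> 'h \<Rightarrow> complex) \<Rightarrow> 'h \<Rightarrow> real"
  where "form_norm h u = sqrt (Re (h u u) + (norm u)\<^sup>2)"

text \<open>The last condition is closedness: the domain is complete for the form norm. Hermitian
  symmetry holds automatically for a sesquilinear form with non-negative quadratic form;
  it gives conjugate linearity in the second argument and real-valuedness on the diagonal.\<close>

locale closed_nonneg_form =
  fixes D :: "'h::chilbert_space set" and h :: "'h \<Rightarrow> 'h \<Rightarrow> complex"
  assumes dom_subspace: "csubspace D"
    and dom_dense: "closure D = UNIV"
    and form_add_left: "\<lbrakk>u \<in> D; v \<in> D; w \<in> D\<rbrakk> \<Longrightarrow> h (u + v) w = h u w + h v w"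
    and form_scaleC_left: "\<lbrakk>u \<in> D; v \<in> D\<rbrakk> \<Longrightarrow> h (a *\<^sub>C u) v = a * h u v"
    and form_commute: "\<lbrakk>u \<in> D; v \<in> D\<rbrakk> \<Longrightarrow> h u v = cnj (h v u)"
    and form_nonneg: "u \<in> D \<Longrightarrow> 0 \<le> Re (h u u)"
    and form_closed: "\<lbrakk>\<And>n::nat. s n \<in> D;
        \<forall>e>0. \<exists>N. \<forall>m\<ge>N. \<forall>n\<ge>N. form_norm h (s m - s n) < e\<rbrakk>
      \<Longrightarrow> \<exists>u\<in>D. (\<lambda>n. form_norm h (s n - u)) \<longlonglongrightarrow> 0"

definition bdry_ker :: "'h set \<Rightarrow> ('h \<Rightarrow> 'g::zero) \<Rightarrow> 'h set"
  where "bdry_ker D \<Gamma> = {u \<in> D. \<Gamma> u = 0}"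

locale boundary_pair = closed_nonneg_form D h
  for D :: "'h::chilbert_space set" and h :: "'h \<Rightarrow> 'h \<Rightarrow> complex" +
  fixes \<Gamma> :: "'h \<Rightarrow> 'g::chilbert_space"
  assumes bdry_add: "\<lbrakk>u \<in> D; v \<in> D\<rbrakk> \<Longrightarrow> \<Gamma> (u + v) = \<Gamma> u + \<Gamma> v"
    and bdry_scaleC: "u \<in> D \<Longrightarrow> \<Gamma> (a *\<^sub>C u) = a *\<^sub>C \<Gamma> u"
    and bdry_bounded: "\<exists>C. \<forall>u\<in>D. norm (\<Gamma> u) \<le> C * form_norm h u"
    and ker_dense: "closure (bdry_ker D \<Gamma>) = UNIV"
    and ran_dense: "closure (\<Gamma> ` D) = UNIV"

definition neumann_op :: "'h::chilbert_space set \<Rightarrow> ('h \<Rightarrow> 'h \<Rightarrow> complex) \<Rightarrow> ('h, 'h) op_graph"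
  where "neumann_op D h = form_op D h"

definition dirichlet_op ::
    "'h::chilbert_space set \<Rightarrow> ('h \<Rightarrow> 'h \<Rightarrow> complex) \<Rightarrow> ('h \<Rightarrow> 'g::chilbert_space) \<Rightarrow> ('h, 'h) op_graph"
  where "dirichlet_op D h \<Gamma> = form_op (bdry_ker D \<Gamma>) h"

text \<open>Weak solutions, i.e. the space \<open>\<N>\<^sup>1(z)\<close>.\<close>

definition weak_sol ::
    "'h::chilbert_space set \<Rightarrow> ('h \<Rightarrow> 'h \<Rightarrow> complex) \<Rightarrow> ('h \<Rightarrow> 'g::chilbert_space) \<Rightarrow> complex \<Rightarrow> 'h set"
  where "weak_sol D h \<Gamma> z = {u \<in> D. \<forall>f \<in> bdry_ker D \<Gamma>. h u f = z * cinner u f}"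

text \<open>For \<open>z\<close> outside the Dirichlet spectrum, \<open>\<Gamma>\<close> maps \<open>weak_sol D h \<Gamma> z\<close> bijectively
  onto \<open>\<Gamma> ` D\<close>, and this is its inverse.\<close>

definition dirichlet_sol ::
    "'h::chilbert_space set \<Rightarrow> ('h \<Rightarrow> 'h \<Rightarrow> complex) \<Rightarrow> ('h \<Rightarrow> 'g::chilbert_space) \<Rightarrow> complex \<Rightarrow> 'g \<Rightarrow> 'h"
  where "dirichlet_sol D h \<Gamma> z = inv_into (weak_sol D h \<Gamma> z) \<Gamma>"

definition dtn_form ::
    "'h::chilbert_space set \<Rightarrow> ('h \<Rightarrow> 'h \<Rightarrow> complex) \<Rightarrow> ('h \<Rightarrow> 'g::chilbert_space) \<Rightarrow> complex
      \<Rightarrow> 'g \<Rightarrow> 'g \<Rightarrow> complex"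
  where "dtn_form D h \<Gamma> z \<phi> \<psi> =
    h (dirichlet_sol D h \<Gamma> z \<phi>) (dirichlet_sol D h \<Gamma> (-1) \<psi>)
    - z * cinner (dirichlet_sol D h \<Gamma> z \<phi>) (dirichlet_sol D h \<Gamma> (-1) \<psi>)"

definition dtn_op ::
    "'h::chilbert_space set \<Rightarrow> ('h \<Rightarrow> 'h \<Rightarrow> complex) \<Rightarrow> ('h \<Rightarrow> 'g::chilbert_space) \<Rightarrow> complex
      \<Rightarrow> ('g, 'g) op_graph"
  where "dtn_op D h \<Gamma> z = form_op (\<Gamma> ` D) (dtn_form D h \<Gamma> z)"

locale elliptically_regular_boundary_pair = boundary_pair D h \<Gamma>
  for D :: "'h::chilbert_space set" and h :: "'h \<Rightarrow> 'h \<Rightarrow> complex"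
    and \<Gamma> :: "'h \<Rightarrow> 'g::chilbert_space" +
  assumes elliptic_regularity:
    "\<exists>c>0. \<forall>\<phi> \<in> \<Gamma> ` D. norm (dirichlet_sol D h \<Gamma> (-1) \<phi>) \<le> c * norm \<phi>"

text \<open>The unique bounded extension of the Dirichlet solution operator, which exists for
  elliptically regular boundary pairs and \<open>z\<close> outside the Dirichlet spectrum.\<close>

definition dirichlet_sol_ext ::
    "'h::chilbert_space set \<Rightarrow> ('h \<Rightarrow> 'h \<Rightarrow> complex) \<Rightarrow> ('h \<Rightarrow> 'g::chilbert_space) \<Rightarrow> complex \<Rightarrow> 'g \<Rightarrow> 'h"
  where "dirichlet_sol_ext D h \<Gamma> z =
    (THE T. bounded_clinear T \<and> (\<forall>\<phi> \<in> \<Gamma> ` D. T \<phi> = dirichlet_sol D h \<Gamma> z \<phi>))"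

end

theory Submission
  imports Defs
begin

text \<open>Write \<open>R\<^sub>D\<close>, \<open>R\<^sub>N\<close> for the Dirichlet and Neumann resolvents at \<open>z\<close>. For \<open>\<phi>\<close> in the range of \<open>\<Gamma>\<close>,
  \<open>\<Lambda>(z) \<phi> = \<eta>\<close> says that \<open>u = S(z) \<phi>\<close> solves the Neumann problem
  \<open>h(u, v) - z \<langle>u, v\<rangle> = \<langle>\<eta>, \<Gamma> v\<rangle>\<close> for all \<open>v\<close> in the form domain. If \<open>z\<close> is in the Neumann resolvent set,
  this problem has the unique solution \<open>u = w + (z + 1) R\<^sub>N w\<close>, where \<open>w\<close> is the Riesz representative
  of the right-hand side in the form domain, and hence \<open>\<Lambda>(z)\<close> is boundedly invertible. Conversely,
  Green's formula \<open>h(R\<^sub>D f, v) - z \<langle>R\<^sub>D f, v\<rangle> = \<langle>f, v\<rangle> - \<langle>S(cnj z)\<^sup>* f, \<Gamma> v\<rangle>\<close> shows that adding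
  \<open>S(z) \<Lambda>(z)\<^sup>-\<^sup>1 S(cnj z)\<^sup>* f\<close> to \<open>R\<^sub>D f\<close> cancels the boundary term, so the sum is \<open>R\<^sub>N f\<close>.\<close>

section \<open>Complex inner product spaces\<close>

lemma scaleC_zero_left [simp]: "0 *\<^sub>C x = (0 :: 'a::complex_inner)"
  using scaleR_scaleC[of 0 x] by simp

lemma scaleC_one [simp]: "1 *\<^sub>C x = (x :: 'a::complex_inner)"
  using scaleR_scaleC[of 1 x] by simp

lemma scaleC_minus_one [simp]: "(- 1) *\<^sub>C x = - (x :: 'a::complex_inner)"
  using scaleR_scaleC[of "- 1" x] by simp

lemma scaleC_zero_right [simp]: "a *\<^sub>C 0 = (0 :: 'a::complex_inner)"
  using scaleC_scaleC[of a 0 "0::'a"] by simp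

lemma scaleC_minus_right: "a *\<^sub>C (- x) = - (a *\<^sub>C x :: 'a::complex_inner)"
  using scaleC_add_right[of a x "- x"] by (simp add: eq_neg_iff_add_eq_0 add.commute)

lemma scaleC_diff_right: "a *\<^sub>C (x - y) = a *\<^sub>C x - a *\<^sub>C (y :: 'a::complex_inner)"
  using scaleC_add_right[of a x "- y"] by (simp add: scaleC_minus_right)

lemma cinner_add_right: "cinner w (x + y) = cinner w x + cinner w (y :: 'a::complex_inner)"
  by (simp only: cinner_commute[of w] cinner_add_left complex_cnj_add)

lemma cinner_scaleC_right: "cinner x (a *\<^sub>C y) = cnj a * cinner x (y :: 'a::complex_inner)"
  by (simp only: cinner_commute[of x] cinner_scaleC_left complex_cnj_mult)

lemma cinner_zero_left [simp]: "cinner 0 (x :: 'a::complex_inner) = 0"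
  using cinner_diff_left[of x x x] by simp

lemma cinner_zero_right [simp]: "cinner (x :: 'a::complex_inner) 0 = 0"
  using cinner_diff_right[of x x x] by simp

lemma cinner_eqI:
  assumes "\<And>v. cinner x v = cinner (y :: 'a::complex_inner) v"
  shows "x = y"
  using cinner_dense_eq_0[of UNIV "x - y"] assms by (simp add: cinner_diff_left)

lemma norm_scaleC: "norm (a *\<^sub>C x) = cmod a * norm (x :: 'a::complex_inner)"
proof -
  have "complex_of_real ((norm (a *\<^sub>C x))\<^sup>2) = (a * cnj a) * cinner x x"
    by (simp only: cinner_self[symmetric] cinner_scaleC_left cinner_scaleC_right mult.assoc mult.left_commute)
  also have "\<dots> = complex_of_real ((cmod a * norm x)\<^sup>2)"
    by (simp only: cinner_self complex_norm_square[symmetric] of_real_mult power_mult_distrib)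
  finally have "(norm (a *\<^sub>C x))\<^sup>2 = (cmod a * norm x)\<^sup>2"
    using of_real_eq_iff by blast
  then show ?thesis
    by simp
qed

lemma csubspace_diff: "csubspace D \<Longrightarrow> u \<in> D \<Longrightarrow> v \<in> D \<Longrightarrow> u - v \<in> D"
  unfolding csubspace_def by (metis scaleC_minus_one uminus_add_conv_diff add.commute)

lemma csubspace_UNIV: "csubspace UNIV"
  by (simp add: csubspace_def)

text \<open>Stated for semidefinite forms on a subspace so that it serves both the inner product and
  the form inner product \<open>ip\<close>. Non-negativity of \<open>q\<close> along the line
  through \<open>u\<close> in direction \<open>q u v *\<^sub>C v\<close> gives a real quadratic in
  \<open>t\<close>.\<close>

lemma nonneg_hermitian_Cauchy_Schwarz:
  fixes q :: "'a::complex_inner \<Rightarrow> 'a \<Rightarrow> complex"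
  assumes D: "csubspace D"
    and add: "\<And>u v w. u \<in> D \<Longrightarrow> v \<in> D \<Longrightarrow> w \<in> D \<Longrightarrow> q (u + v) w = q u w + q v w"
    and scale: "\<And>a u v. u \<in> D \<Longrightarrow> v \<in> D \<Longrightarrow> q (a *\<^sub>C u) v = a * q u v"
    and comm: "\<And>u v. u \<in> D \<Longrightarrow> v \<in> D \<Longrightarrow> q u v = cnj (q v u)"
    and nonneg: "\<And>u. u \<in> D \<Longrightarrow> 0 \<le> Re (q u u)"
    and u: "u \<in> D" and v: "v \<in> D"
  shows "(cmod (q u v))\<^sup>2 \<le> Re (q u u) * Re (q v v)"
proof -
  define A B C where "A = Re (q u u)" and "B = (cmod (q u v))\<^sup>2" and "C = Re (q v v)"
  have quad: "0 \<le> A - 2 * t * B + t\<^sup>2 * B * C" for t :: real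
  proof -
    \<comment> \<open>This factor makes both cross terms equal to the same real number
      \<open>- (t * B)\<close>.\<close>
    define a where "a = - complex_of_real t * q u v"
    have aD: "a *\<^sub>C v \<in> D" and uaD: "u + a *\<^sub>C v \<in> D"
      using D u v by (auto simp: csubspace_def)
    have addr: "q x (y + z) = q x y + q x z" if "x \<in> D" "y \<in> D" "z \<in> D" for x y z
    proof -
      have "y + z \<in> D"
        using D that by (simp add: csubspace_def)
      then show ?thesis
        using that by (simp add: comm[of x] add)
    qed
    have scaler: "q x (b *\<^sub>C y) = cnj b * q x y" if "x \<in> D" "y \<in> D" for x y b
    proof -
      have "b *\<^sub>C y \<in> D"
        using D that by (simp add: csubspace_def)
      then show ?thesis
        using that by (simp add: comm[of x] scale)
    qed
    have "q (u + a *\<^sub>C v) (u + a *\<^sub>C v)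
        = q u u + cnj a * q u v + (a * q v u + a * (cnj a * q v v))"
      using u v aD uaD by (simp add: add addr scale scaler distrib_left)
    moreover have "cnj a * q u v = - complex_of_real (t * B)"
      unfolding a_def B_def of_real_mult complex_norm_square by simp
    moreover have "a * q v u = - complex_of_real (t * B)"
      unfolding a_def B_def of_real_mult complex_norm_square comm[OF v u] by simp
    moreover have "a * (cnj a * q v v) = complex_of_real (t\<^sup>2 * B) * q v v"
      unfolding a_def B_def of_real_mult complex_norm_square by (simp add: power2_eq_square)
    ultimately have eq: "q (u + a *\<^sub>C v) (u + a *\<^sub>C v)
        = q u u - complex_of_real (2 * t * B) + complex_of_real (t\<^sup>2 * B) * q v v"
      by simp
    have "Re (q (u + a *\<^sub>C v) (u + a *\<^sub>C v)) = A - 2 * t * B + t\<^sup>2 * B * C"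
      unfolding eq A_def C_def by (simp del: of_real_mult of_real_power)
    then show ?thesis
      using nonneg[OF uaD] by simp
  qed
  have "0 \<le> B" "0 \<le> C" "0 \<le> A"
    using nonneg u v by (simp_all add: A_def B_def C_def)
  show ?thesis
    unfolding A_def[symmetric] B_def[symmetric] C_def[symmetric]
  proof (cases "C = 0")
    case True
    have "B = 0"
    proof (rule ccontr)
      assume "B \<noteq> 0"
      \<comment> \<open>With \<open>C = 0\<close> the quadratic is affine in \<open>t\<close>, and
        this \<open>t\<close> gives it the value \<open>- 1\<close>.\<close>
      then show False
        using quad[of "(A + 1) / (2 * B)"] True by simp
    qed
    then show "B \<le> A * C"
      using True by simp
  next
    case False
    \<comment> \<open>For positive \<open>B\<close>, the quadratic attains its minimum at
      \<open>t = 1 / C\<close>.\<close>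
    then have "0 \<le> A - B / C"
      using quad[of "1 / C"] by (simp add: power2_eq_square)
    then show "B \<le> A * C"
      using False \<open>0 \<le> C\<close> by (simp add: field_simps)
  qed
qed

lemma cinner_Cauchy_Schwarz: "cmod (cinner x y) \<le> norm x * norm (y :: 'a::complex_inner)"
proof -
  have "(cmod (cinner x y))\<^sup>2 \<le> Re (cinner x x) * Re (cinner y y)"
    by (rule nonneg_hermitian_Cauchy_Schwarz[OF csubspace_UNIV])
      (simp_all add: cinner_add_left cinner_scaleC_left cinner_self cinner_commute[symmetric])
  then have "(cmod (cinner x y))\<^sup>2 \<le> (norm x * norm y)\<^sup>2"
    by (simp add: cinner_self power_mult_distrib)
  then show ?thesis
    by (rule power2_le_imp_le) simp
qed


section \<open>Bounded operators and invertible linear relations\<close>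

lemma bounded_clinearI:
  assumes "\<And>x y. T (x + y) = T x + T y" "\<And>a x. T (a *\<^sub>C x) = a *\<^sub>C T x"
    and "\<And>x. norm (T x) \<le> norm x * c"
  shows "bounded_clinear T"
  unfolding bounded_clinear_def using assms
  by (auto intro!: bounded_linear_intro[of T c] simp: scaleR_scaleC)

lemma bounded_clinear_add:
  "bounded_clinear T \<Longrightarrow> T (x + y) = T x + T y"
  unfolding bounded_clinear_def using linear_simps(1) by blast

lemma bounded_clinear_scaleC:
  "bounded_clinear T \<Longrightarrow> T (a *\<^sub>C x) = a *\<^sub>C T x"
  by (simp add: bounded_clinear_def)

lemma bounded_clinear_pos_bound:
  assumes "bounded_clinear T"
  obtains c where "0 < c" "\<And>x. norm (T x) \<le> c * norm x"
  using assms bounded_linear.pos_bounded unfolding bounded_clinear_def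
  by (metis mult.commute)

lemma bounded_clinear_fun_add:
  "bounded_clinear S \<Longrightarrow> bounded_clinear T \<Longrightarrow> bounded_clinear (\<lambda>x. S x + T x)"
  by (auto simp: bounded_clinear_def scaleC_add_right intro: bounded_linear_add)

lemma bounded_clinear_fun_diff:
  "bounded_clinear S \<Longrightarrow> bounded_clinear T \<Longrightarrow> bounded_clinear (\<lambda>x. S x - T x)"
  by (auto simp: bounded_clinear_def scaleC_diff_right intro: bounded_linear_sub)

lemma bounded_clinear_compose:
  "bounded_clinear S \<Longrightarrow> bounded_clinear T \<Longrightarrow> bounded_clinear (\<lambda>x. S (T x))"
  by (auto simp: bounded_clinear_def intro: bounded_linear_compose)

lemma boundedly_invertibleD:
  assumes "boundedly_invertible A"
  shows "(op_inv A f, f) \<in> A" and "(u, f) \<in> A \<Longrightarrow> op_inv A f = u"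
    and "bounded_clinear (op_inv A)"
  using assms theI'[of "\<lambda>u. (u, f) \<in> A"]
  unfolding boundedly_invertible_def op_inv_def by (auto intro: the1_equality)

lemma boundedly_invertibleI:
  assumes T: "bounded_clinear T" and "\<And>f. (T f, f) \<in> A"
    and "\<And>u f. (u, f) \<in> A \<Longrightarrow> u = T f"
  shows "boundedly_invertible A" and "op_inv A = T"
proof -
  show eq: "op_inv A = T"
    unfolding op_inv_def using assms(2,3) by (intro ext the_equality) auto
  show "boundedly_invertible A"
    unfolding boundedly_invertible_def eq using T assms(2,3) by blast
qed

text \<open>The bound at \<open>f = 0\<close> gives injectivity, which makes a choice of preimages
  linear, and the same bound makes it continuous. Solvability and one estimate thus settle
  \<open>H + 1\<close>, adjoints and the Dirichlet-to-Neumann operator.\<close>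

lemma boundedly_invertible_linear_relation:
  assumes add: "\<And>u f v g. (u, f) \<in> A \<Longrightarrow> (v, g) \<in> A \<Longrightarrow> (u + v, f + g) \<in> A"
    and scale: "\<And>a u f. (u, f) \<in> A \<Longrightarrow> (a *\<^sub>C u, a *\<^sub>C f) \<in> A"
    and surj: "\<And>f. \<exists>u. (u, f) \<in> A"
    and bound: "\<And>u f. (u, f) \<in> A \<Longrightarrow> norm u \<le> c * norm f"
  shows "boundedly_invertible A"
proof -
  have unique: "u = v" if "(u, f) \<in> A" "(v, f) \<in> A" for u v f
  proof -
    have "(u - v, 0) \<in> A"
      using add[OF that(1) scale[OF that(2), of "- 1"]] by simp
    then show ?thesis
      using bound by fastforce
  qed
  obtain T where T: "\<And>f. (T f, f) \<in> A"
    using surj by metis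
  have "bounded_clinear T"
    using unique[OF T add[OF T T]] unique[OF T scale[OF T]] bound[OF T]
    by (auto intro!: bounded_clinearI[of T c] simp: mult.commute)
  then show ?thesis
    using T unique by (intro boundedly_invertibleI) auto
qed

section \<open>Operators of shifted forms and their resolvents\<close>

lemma op_shift_form_op:
  "op_shift (form_op D q) z = form_op D (\<lambda>u v. q u v - z * cinner u v)"
proof (intro set_eqI iffI; clarify)
  fix u g
  assume "(u, g) \<in> op_shift (form_op D q) z"
  then show "(u, g) \<in> form_op D (\<lambda>u v. q u v - z * cinner u v)"
    by (auto simp: op_shift_def form_op_def cinner_diff_left cinner_scaleC_left)
next
  fix u g
  assume "(u, g) \<in> form_op D (\<lambda>u v. q u v - z * cinner u v)"
  then have "(u, g + z *\<^sub>C u) \<in> form_op D q"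
    by (auto simp: form_op_def cinner_add_left cinner_scaleC_left algebra_simps)
  then show "(u, g) \<in> op_shift (form_op D q) z"
    unfolding op_shift_def by force
qed

lemma op_shift_zero [simp]: "op_shift A 0 = A"
  by (auto simp: op_shift_def)

lemma form_op_iff: "(u, f) \<in> form_op D q \<longleftrightarrow> u \<in> D \<and> (\<forall>v\<in>D. q u v = cinner f v)"
  by (simp add: form_op_def)

text \<open>The third claim is what identifies resolvents later: a vector is the resolvent of
  \<open>f\<close> as soon as it satisfies the weak equation.\<close>

lemma resolventD:
  assumes "z \<notin> spectrum (form_op D q)"
  shows "resolvent (form_op D q) z f \<in> D"
    and "v \<in> D \<Longrightarrow> q (resolvent (form_op D q) z f) v
        - z * cinner (resolvent (form_op D q) z f) v = cinner f v"
    and "u \<in> D \<Longrightarrow> (\<And>v. v \<in> D \<Longrightarrow> q u v - z * cinner u v = cinner f v)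
        \<Longrightarrow> resolvent (form_op D q) z f = u"
    and "bounded_clinear (resolvent (form_op D q) z)"
proof -
  have inv: "boundedly_invertible (form_op D (\<lambda>u v. q u v - z * cinner u v))"
    using assms by (simp add: spectrum_def op_shift_form_op)
  note R = boundedly_invertibleD[OF inv]
  show "resolvent (form_op D q) z f \<in> D"
    and "v \<in> D \<Longrightarrow> q (resolvent (form_op D q) z f) v
        - z * cinner (resolvent (form_op D q) z f) v = cinner f v"
    using R(1)[of f] unfolding resolvent_def op_shift_form_op form_op_iff by auto
  show "u \<in> D \<Longrightarrow> (\<And>v. v \<in> D \<Longrightarrow> q u v - z * cinner u v = cinner f v)
        \<Longrightarrow> resolvent (form_op D q) z f = u"
    unfolding resolvent_def op_shift_form_op by (rule R(2)) (simp add: form_op_iff)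
  show "bounded_clinear (resolvent (form_op D q) z)"
    using R(3) unfolding resolvent_def op_shift_form_op .
qed

text \<open>The map is Lipschitz on \<open>X\<close>, so completeness of the target yields a
  continuous extension. Each required identity or bound holds on a closed set containing
  \<open>X\<close>, hence everywhere.\<close>

lemma bounded_clinear_extension:
  fixes f :: "'a::complex_inner \<Rightarrow> 'b::chilbert_space"
  assumes X: "csubspace X" and dense: "closure X = UNIV"
    and add: "\<And>x y. x \<in> X \<Longrightarrow> y \<in> X \<Longrightarrow> f (x + y) = f x + f y"
    and scale: "\<And>a x. x \<in> X \<Longrightarrow> f (a *\<^sub>C x) = a *\<^sub>C f x"
    and bound: "\<And>x. x \<in> X \<Longrightarrow> norm (f x) \<le> c * norm x"
  shows "\<exists>!T. bounded_clinear T \<and> (\<forall>x\<in>X. T x = f x)"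
proof -
  have dense_induct: "x \<in> S" if "closed S" "X \<subseteq> S" for x and S :: "'a set"
    using closure_minimal[OF that(2,1)] dense by auto
  have X_add: "x + y \<in> X" and X_scale: "a *\<^sub>C x \<in> X" if "x \<in> X" "y \<in> X" for x y a
    using X that by (auto simp: csubspace_def)
  have diff: "f x - f y = f (x - y)" if "x \<in> X" "y \<in> X" for x y
    using add[OF csubspace_diff[OF X that] that(2)] by simp
  have "uniformly_continuous_on X f"
  \<comment> \<open>A Lipschitz constant must be non-negative, hence the absolute value of
    \<open>c\<close>.\<close>
  proof (rule lipschitz_on_uniformly_continuous)
    show "\<bar>c\<bar>-lipschitz_on X f"
    proof (rule lipschitz_onI)
      fix x y assume xy: "x \<in> X" "y \<in> X"
      have "norm (f (x - y)) \<le> c * norm (x - y)"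
        using bound csubspace_diff[OF X xy] by blast
      also have "\<dots> \<le> \<bar>c\<bar> * norm (x - y)"
        by (rule mult_right_mono) auto
      finally show "dist (f x) (f y) \<le> \<bar>c\<bar> * dist x y"
        using xy by (simp add: dist_norm diff)
    qed simp
  qed
  then obtain T where "uniformly_continuous_on (closure X) T" and ext: "\<And>x. x \<in> X \<Longrightarrow> f x = T x"
    by (rule uniformly_continuous_on_extension_on_closure) blast
  then have cont: "continuous_on UNIV T"
    using dense by (simp add: uniformly_continuous_imp_continuous)
  have cont_scale: "continuous_on UNIV (\<lambda>x. a *\<^sub>C x :: 'c::complex_inner)" for a
  proof -
    have "bounded_clinear (\<lambda>x. a *\<^sub>C x)"
      by (rule bounded_clinearI[of _ "cmod a"])
        (simp_all add: scaleC_add_right scaleC_scaleC norm_scaleC mult.commute)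
    then show ?thesis
      by (auto simp: bounded_clinear_def intro: linear_continuous_on)
  qed
  have cont_T: "continuous_on UNIV (\<lambda>x. T (g x))" if "continuous_on UNIV g"
    for g :: "'a \<Rightarrow> 'a"
    using continuous_on_compose2[OF cont that] by simp
  \<comment> \<open>Additivity is extended one variable at a time: first in \<open>y\<close> with
    \<open>x\<close> in \<open>X\<close>, then in \<open>x\<close> for arbitrary
    \<open>y\<close>.\<close>
  have add1: "T (x + y) = T x + T y" if "x \<in> X" for x y
  proof -
    have "y \<in> {y. T (x + y) = T x + T y}"
    proof (rule dense_induct)
      show "closed {y. T (x + y) = T x + T y}"
        by (intro closed_Collect_eq cont_T continuous_intros cont)
    qed (use that X_add add in \<open>auto simp: ext[symmetric]\<close>)
    then show ?thesis by simp
  qed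
  have "bounded_clinear T"
  proof (rule bounded_clinearI)
    fix x y
    have "x \<in> {x. T (x + y) = T x + T y}"
    proof (rule dense_induct)
      show "closed {x. T (x + y) = T x + T y}"
        by (intro closed_Collect_eq cont_T continuous_intros cont)
    qed (use add1 in auto)
    then show "T (x + y) = T x + T y" by simp
  next
    fix a x
    have "x \<in> {x. T (a *\<^sub>C x) = a *\<^sub>C T x}"
    proof (rule dense_induct)
      show "closed {x. T (a *\<^sub>C x) = a *\<^sub>C T x}"
        by (intro closed_Collect_eq cont_T cont_scale continuous_on_compose2[OF cont_scale cont]) auto
    qed (use X_scale scale in \<open>auto simp: ext[symmetric]\<close>)
    then show "T (a *\<^sub>C x) = a *\<^sub>C T x" by simp
  next
    fix x
    have "x \<in> {x. norm (T x) \<le> norm x * c}"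
    proof (rule dense_induct)
      show "closed {x. norm (T x) \<le> norm x * c}"
        by (intro closed_Collect_le continuous_intros cont)
    qed (use bound in \<open>auto simp: ext[symmetric] mult.commute\<close>)
    then show "norm (T x) \<le> norm x * c" by simp
  qed
  moreover have "T' = T" if T': "bounded_clinear T'" "\<And>x. x \<in> X \<Longrightarrow> T' x = f x" for T'
  proof
    fix x
    have "x \<in> {x. T' x = T x}"
    proof (rule dense_induct)
      show "closed {x. T' x = T x}"
        using T'(1) by (intro closed_Collect_eq cont)
          (simp add: bounded_clinear_def linear_continuous_on)
    qed (use T'(2) ext in auto)
    then show "T' x = T x" by simp
  qed
  ultimately show ?thesis
    using ext by (intro ex1I[of _ T]) auto
qed


section \<open>Closed forms\<close>

context closed_nonneg_form
begin

lemma dom_add [simp]: "u \<in> D \<Longrightarrow> v \<in> D \<Longrightarrow> u + v \<in> D"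
  and dom_scaleC [simp]: "u \<in> D \<Longrightarrow> a *\<^sub>C u \<in> D"
  and dom_diff [simp]: "u \<in> D \<Longrightarrow> v \<in> D \<Longrightarrow> u - v \<in> D"
  and dom_zero [simp]: "0 \<in> D"
  using dom_subspace csubspace_diff by (auto simp: csubspace_def)

lemma form_add_right: "\<lbrakk>u \<in> D; v \<in> D; w \<in> D\<rbrakk> \<Longrightarrow> h u (v + w) = h u v + h u w"
  by (simp add: form_commute[of u] form_add_left)

lemma form_scaleC_right: "\<lbrakk>u \<in> D; v \<in> D\<rbrakk> \<Longrightarrow> h u (a *\<^sub>C v) = cnj a * h u v"
  by (simp add: form_commute[of u] form_scaleC_left)

lemma form_diff_left: "\<lbrakk>u \<in> D; v \<in> D; w \<in> D\<rbrakk> \<Longrightarrow> h (u - v) w = h u w - h v w"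
  using form_add_left[of "u - v" v w] by simp

lemma form_diff_right: "\<lbrakk>u \<in> D; v \<in> D; w \<in> D\<rbrakk> \<Longrightarrow> h u (v - w) = h u v - h u w"
  using form_add_right[of u "v - w" w] by simp

text \<open>The inner product of the form domain, inducing \<open>form_norm\<close>; it is also the
  form of \<open>H + 1\<close>.\<close>

definition ip :: "'h \<Rightarrow> 'h \<Rightarrow> complex"
  where "ip u v = h u v + cinner u v"

lemma ip_add_left: "\<lbrakk>u \<in> D; v \<in> D; w \<in> D\<rbrakk> \<Longrightarrow> ip (u + v) w = ip u w + ip v w"
  by (simp add: ip_def form_add_left cinner_add_left)

lemma ip_add_right: "\<lbrakk>u \<in> D; v \<in> D; w \<in> D\<rbrakk> \<Longrightarrow> ip u (v + w) = ip u v + ip u w"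
  by (simp add: ip_def form_add_right cinner_add_right)

lemma ip_diff_left: "\<lbrakk>u \<in> D; v \<in> D; w \<in> D\<rbrakk> \<Longrightarrow> ip (u - v) w = ip u w - ip v w"
  by (simp add: ip_def form_diff_left cinner_diff_left)

lemma ip_diff_right: "\<lbrakk>u \<in> D; v \<in> D; w \<in> D\<rbrakk> \<Longrightarrow> ip u (v - w) = ip u v - ip u w"
  by (simp add: ip_def form_diff_right cinner_diff_right)

lemma ip_scaleC_left: "\<lbrakk>u \<in> D; v \<in> D\<rbrakk> \<Longrightarrow> ip (a *\<^sub>C u) v = a * ip u v"
  by (simp add: ip_def form_scaleC_left cinner_scaleC_left distrib_left)

lemma ip_scaleC_right: "\<lbrakk>u \<in> D; v \<in> D\<rbrakk> \<Longrightarrow> ip u (a *\<^sub>C v) = cnj a * ip u v"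
  by (simp add: ip_def form_scaleC_right cinner_scaleC_right distrib_left)

lemma ip_commute: "\<lbrakk>u \<in> D; v \<in> D\<rbrakk> \<Longrightarrow> ip u v = cnj (ip v u)"
  by (simp add: ip_def form_commute[of u] cinner_commute[of u])

lemma form_norm_sq: "u \<in> D \<Longrightarrow> (form_norm h u)\<^sup>2 = Re (ip u u)"
  by (simp add: form_norm_def ip_def form_nonneg cinner_self)

lemma form_norm_nonneg: "u \<in> D \<Longrightarrow> 0 \<le> form_norm h u"
  by (simp add: form_norm_def form_nonneg)

lemma norm_le_form_norm: "u \<in> D \<Longrightarrow> norm u \<le> form_norm h u"
  unfolding form_norm_def by (rule real_le_rsqrt) (simp add: form_nonneg)

lemma ip_Cauchy_Schwarz:
  assumes "u \<in> D" "v \<in> D"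
  shows "cmod (ip u v) \<le> form_norm h u * form_norm h v"
proof -
  have "(cmod (ip u v))\<^sup>2 \<le> Re (ip u u) * Re (ip v v)"
    by (rule nonneg_hermitian_Cauchy_Schwarz[OF dom_subspace _ _ _ _ assms])
      (simp_all add: ip_add_left ip_scaleC_left ip_commute[symmetric] form_norm_sq[symmetric])
  also have "\<dots> = (form_norm h u * form_norm h v)\<^sup>2"
    using assms by (simp add: form_norm_sq power_mult_distrib)
  finally show ?thesis
    by (rule power2_le_imp_le) (simp add: form_norm_nonneg assms)
qed

text \<open>The representing vector minimizes \<open>J v = \<parallel>v\<parallel>\<^sup>2 - 2 Re (F v)\<close>, with the form norm; the
  parallelogram law makes minimizing sequences Cauchy.\<close>

lemma form_riesz:
  assumes add: "\<And>u v. u \<in> D \<Longrightarrow> v \<in> D \<Longrightarrow> F (u + v) = F u + F v"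
    and scale: "\<And>a u. u \<in> D \<Longrightarrow> F (a *\<^sub>C u) = a * F u"
    and bound: "\<And>u. u \<in> D \<Longrightarrow> cmod (F u) \<le> C * form_norm h u"
  obtains w where "w \<in> D" "\<And>v. v \<in> D \<Longrightarrow> ip v w = F v"
proof -
  define J where "J v = (form_norm h v)\<^sup>2 - 2 * Re (F v)" for v
  have J_add: "J (u + v) = J u + 2 * Re (ip v u) + (form_norm h v)\<^sup>2 - 2 * Re (F v)"
    if "u \<in> D" "v \<in> D" for u v
    using that ip_commute[OF that]
    by (simp add: J_def form_norm_sq ip_add_left ip_add_right add)
  have norm_scale: "(form_norm h (complex_of_real t *\<^sub>C v))\<^sup>2 = t\<^sup>2 * (form_norm h v)\<^sup>2"
    if "v \<in> D" for t v
    using that by (simp add: form_norm_sq ip_scaleC_left ip_scaleC_right power2_eq_square[of t])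
  \<comment> \<open>Completing the square in \<open>form_norm h v - C\<close>.\<close>
  have J_below: "- C\<^sup>2 \<le> J v" if "v \<in> D" for v
  proof -
    have "Re (F v) \<le> C * form_norm h v"
      using bound[OF that] complex_Re_le_cmod[of "F v"] by linarith
    moreover have "0 \<le> (form_norm h v - C)\<^sup>2"
      by simp
    ultimately show ?thesis
      by (simp add: J_def power2_eq_square algebra_simps)
  qed
  define m where "m = Inf (J ` D)"
  have bdd: "bdd_below (J ` D)"
    using bdd_belowI2[OF J_below] .
  have m_le: "m \<le> J v" if "v \<in> D" for v
    unfolding m_def using that bdd by (intro cInf_lower) auto
  have "\<exists>v\<in>D. J v < m + inverse (real (Suc n))" for n
  proof -
    have "J ` D \<noteq> {}" "Inf (J ` D) < m + inverse (real (Suc n))"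
      using dom_zero unfolding m_def by (blast, simp)
    from cInf_lessD[OF this] show ?thesis
      by blast
  qed
  then obtain s where s: "\<And>n. s n \<in> D" "\<And>n. J (s n) < m + inverse (real (Suc n))"
    by metis
  have parallelogram: "(form_norm h (u - v))\<^sup>2 \<le> 2 * (J u - m) + 2 * (J v - m)"
    if "u \<in> D" "v \<in> D" for u v
  proof -
    \<comment> \<open>The midpoint competes for the infimum, so \<open>m\<close> is at most
      \<open>J w\<close>; the parallelogram law turns this into a bound on the distance of
      \<open>u\<close> and \<open>v\<close>.\<close>
    define w where "w = complex_of_real (1 / 2) *\<^sub>C (u + v)"
    have w: "w \<in> D"
      using that by (simp add: w_def)
    have "J w = (form_norm h (u + v))\<^sup>2 / 4 - Re (F u) - Re (F v)"
      unfolding J_def w_def using that norm_scale[of "u + v" "1 / 2"]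
      by (simp add: scale add power_divide field_simps)
    moreover have "(form_norm h (u + v))\<^sup>2 + (form_norm h (u - v))\<^sup>2
        = 2 * (form_norm h u)\<^sup>2 + 2 * (form_norm h v)\<^sup>2"
      using that by (simp add: form_norm_sq ip_add_left ip_add_right ip_diff_left ip_diff_right)
    ultimately show ?thesis
      using m_le[OF w] by (simp add: J_def)
  qed
  have "\<forall>e>0. \<exists>N. \<forall>i\<ge>N. \<forall>j\<ge>N. form_norm h (s i - s j) < e"
  proof (intro allI impI)
    fix e :: real
    assume "0 < e"
    then obtain N where N: "inverse (real (Suc N)) < e\<^sup>2 / 4"
      using reals_Archimedean[of "e\<^sup>2 / 4"] by auto
    have "form_norm h (s i - s j) < e" if "i \<ge> N" "j \<ge> N" for i j
    proof -
      have "J (s k) - m < e\<^sup>2 / 4" if "k \<ge> N" for k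
      proof -
        have "inverse (real (Suc k)) \<le> inverse (real (Suc N))"
          using that by (simp add: le_imp_inverse_le)
        then show ?thesis
          using s(2)[of k] N by linarith
      qed
      from this[OF \<open>i \<ge> N\<close>] this[OF \<open>j \<ge> N\<close>]
      have "2 * (J (s i) - m) + 2 * (J (s j) - m) < e\<^sup>2"
        by argo
      then have "(form_norm h (s i - s j))\<^sup>2 < e\<^sup>2"
        using parallelogram[OF s(1) s(1)] by (rule le_less_trans[rotated])
      then show ?thesis
        using \<open>0 < e\<close> by (simp add: power_less_imp_less_base)
    qed
    then show "\<exists>N. \<forall>i\<ge>N. \<forall>j\<ge>N. form_norm h (s i - s j) < e"
      by blast
  qed
  then obtain u where u: "u \<in> D" and lim: "(\<lambda>n. form_norm h (s n - u)) \<longlonglongrightarrow> 0"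
    using form_closed s(1) by blast
  \<comment> \<open>Lower semicontinuity: expanding \<open>J\<close> at \<open>u\<close> with
    increment \<open>s n - u\<close> bounds \<open>J u\<close> by \<open>J (s n)\<close> plus a
    multiple of the form distance.\<close>
  have "J u \<le> m"
  proof (rule LIMSEQ_le)
    show "(\<lambda>n. J u - 2 * (form_norm h u + C) * form_norm h (s n - u)) \<longlonglongrightarrow> J u"
      using tendsto_diff[OF tendsto_const tendsto_mult_right_zero[OF lim]] by simp
    show "(\<lambda>n. m + inverse (real (Suc n))) \<longlonglongrightarrow> m"
      using LIMSEQ_inverse_real_of_nat_add by blast
    have "J u - 2 * (form_norm h u + C) * form_norm h (s n - u) \<le> m + inverse (real (Suc n))" for n
    proof -
      define d where "d = s n - u"
      have d: "d \<in> D"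
        using s(1) u by (simp add: d_def)
      have "- Re (ip d u) \<le> form_norm h u * form_norm h d"
        using ip_Cauchy_Schwarz[OF d u] abs_Re_le_cmod[of "ip d u"] by (simp add: mult.commute)
      moreover have "Re (F d) \<le> C * form_norm h d"
        using bound[OF d] complex_Re_le_cmod[of "F d"] by linarith
      moreover have "J u + 2 * Re (ip d u) - 2 * Re (F d) \<le> J (s n)"
        using J_add[OF u d] by (simp add: d_def)
      ultimately show ?thesis
        using s(2)[of n] unfolding d_def[symmetric] by (simp add: algebra_simps)
    qed
    then show "\<exists>N. \<forall>n\<ge>N. J u - 2 * (form_norm h u + C) * form_norm h (s n - u)
        \<le> m + inverse (real (Suc n))"
      by blast
  qed
  then have min: "J u \<le> J v" if "v \<in> D" for v
    using m_le[OF that] by linarith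
  have Re_eq: "Re (ip v u) = Re (F v)" if v: "v \<in> D" for v
  proof (rule ccontr)
    \<comment> \<open>First variation of \<open>J\<close> in direction \<open>v\<close>:
      \<open>2 * a\<close> is the linear coefficient. The summand 1 keeps \<open>b\<close> positive,
      and \<open>t = - a / b\<close> is small enough for the linear term to win.\<close>
    define a where "a = Re (ip v u) - Re (F v)"
    define b where "b = (form_norm h v)\<^sup>2 + 1"
    assume "Re (ip v u) \<noteq> Re (F v)"
    then have "a\<^sup>2 > 0" by (simp add: a_def)
    have "b > 0"
      by (simp add: b_def add_nonneg_pos)
    have "0 \<le> 2 * t * a + t\<^sup>2 * (b - 1)" for t
    proof -
      have "J (u + complex_of_real t *\<^sub>C v) = J u + 2 * t * a + t\<^sup>2 * (b - 1)"
        using u v by (simp add: J_add norm_scale ip_scaleC_left scale a_def b_def algebra_simps)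
      then show ?thesis
        using min[of "u + complex_of_real t *\<^sub>C v"] u v by simp
    qed
    from this[of "- a / b"] have "0 \<le> - (2 * a\<^sup>2) / b + a\<^sup>2 / b\<^sup>2 * (b - 1)"
      by (simp add: power2_eq_square)
    also have "\<dots> = - (a\<^sup>2) / b - a\<^sup>2 / b\<^sup>2"
      using \<open>b > 0\<close> by (simp add: field_simps power2_eq_square)
    also have "\<dots> < 0"
    proof -
      have "a\<^sup>2 / b > 0" "a\<^sup>2 / b\<^sup>2 > 0"
        using \<open>a\<^sup>2 > 0\<close> \<open>b > 0\<close> by simp_all
      then show ?thesis by simp
    qed
    finally show False by simp
  qed
  have "ip v u = F v" if v: "v \<in> D" for v
  proof (rule complex_eqI)
    show "Re (ip v u) = Re (F v)"
      by (rule Re_eq[OF v])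
    \<comment> \<open>Replacing \<open>v\<close> by \<open>\<i> *\<^sub>C v\<close> turns real parts
      into negated imaginary parts.\<close>
    show "Im (ip v u) = Im (F v)"
      using Re_eq[of "\<i> *\<^sub>C v"] u v by (simp add: ip_scaleC_left scale)
  qed
  then show thesis
    using u that by blast
qed

section \<open>Resolvents of the operator of a closed form\<close>

lemma shifted_form_commute:
  "\<lbrakk>u \<in> D; v \<in> D\<rbrakk> \<Longrightarrow> h u v - z * cinner u v = cnj (h v u - cnj z * cinner v u)"
  by (simp add: form_commute[of u] cinner_commute[of u])

text \<open>The Riesz theorem for \<open>ip\<close> solves the equation of \<open>H + 1\<close>, and
  testing with the solution itself bounds it. The point \<open>- 1\<close> is the base from which
  other \<open>z\<close> are reached by resolvent identities.\<close>

lemma minus_one_notin_spectrum: "- 1 \<notin> spectrum (form_op D h)"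
proof -
  have "boundedly_invertible (form_op D ip)"
  proof (rule boundedly_invertible_linear_relation)
    fix f
    have "cmod (cinner u f) \<le> norm f * form_norm h u" if "u \<in> D" for u
    proof -
      have "cmod (cinner u f) \<le> norm u * norm f"
        by (rule cinner_Cauchy_Schwarz)
      also have "\<dots> \<le> form_norm h u * norm f"
        using norm_le_form_norm[OF that] by (rule mult_right_mono) simp
      finally show ?thesis by (simp add: mult.commute)
    qed
    then obtain w where w: "w \<in> D" "\<And>v. v \<in> D \<Longrightarrow> ip v w = cinner v f"
      using form_riesz[of "\<lambda>u. cinner u f" "norm f"] by (auto simp: cinner_add_left cinner_scaleC_left)
    then have "(w, f) \<in> form_op D ip"
      using ip_commute[OF w(1)] cinner_commute[of f] by (simp add: form_op_iff)
    then show "\<exists>u. (u, f) \<in> form_op D ip" ..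
  next
    fix u f
    assume "(u, f) \<in> form_op D ip"
    then have u: "u \<in> D" "ip u u = cinner f u"
      by (auto simp: form_op_iff)
    have "(norm u)\<^sup>2 \<le> Re (ip u u)"
      using u(1) form_nonneg[of u] by (simp add: ip_def cinner_self)
    also have "\<dots> \<le> norm f * norm u"
      using u(2) cinner_Cauchy_Schwarz[of f u] complex_Re_le_cmod[of "cinner f u"] by simp
    finally show "norm u \<le> 1 * norm f"
      by (cases "norm u = 0") (auto simp: power2_eq_square)
  qed (auto simp: form_op_iff ip_add_left cinner_add_left ip_scaleC_left cinner_scaleC_left)
  then show ?thesis
    by (simp add: spectrum_def op_shift_form_op ip_def[abs_def])
qed

text \<open>Boundary operators are controlled by the form norm, so a bound in the norm of the space
  would not suffice later. Testing the resolvent equation with its solution expresses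
  \<open>ip\<close> through ordinary norms.\<close>

lemma form_norm_resolvent_bound:
  assumes z: "z \<notin> spectrum (form_op D h)"
  obtains c where "0 \<le> c" "\<And>f. form_norm h (resolvent (form_op D h) z f) \<le> c * norm f"
proof -
  let ?R = "resolvent (form_op D h) z"
  note R = resolventD[OF z]
  obtain b where b: "0 < b" "\<And>f. norm (?R f) \<le> b * norm f"
    using bounded_clinear_pos_bound[OF R(4)] by blast
  define c where "c = sqrt (b + (cmod z + 1) * b\<^sup>2)"
  have "form_norm h (?R f) \<le> c * norm f" for f
  proof (rule power2_le_imp_le)
    let ?u = "?R f"
    have "ip ?u ?u = cinner f ?u + (z + 1) * cinner ?u ?u"
      using R(2)[OF R(1), of f f] by (simp add: ip_def algebra_simps)
    then have "cmod (ip ?u ?u) \<le> cmod (cinner f ?u) + cmod (z + 1) * (norm ?u)\<^sup>2"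
      by (metis norm_triangle_ineq norm_mult cinner_self norm_of_real abs_power2)
    also have "\<dots> \<le> norm f * norm ?u + (cmod z + 1) * (norm ?u)\<^sup>2"
      using cinner_Cauchy_Schwarz[of f ?u] norm_triangle_ineq[of z 1]
      by (intro add_mono mult_right_mono) auto
    also have "\<dots> \<le> norm f * (b * norm f) + (cmod z + 1) * (b * norm f)\<^sup>2"
      using b by (intro add_mono mult_left_mono power_mono) auto
    also have "\<dots> = (c * norm f)\<^sup>2"
      using b(1) by (simp add: c_def power_mult_distrib power2_eq_square algebra_simps)
    finally show "(form_norm h ?u)\<^sup>2 \<le> (c * norm f)\<^sup>2"
      using R(1) form_norm_sq complex_Re_le_cmod[of "ip ?u ?u"] by force
  qed (use b(1) in \<open>simp add: c_def\<close>)
  then show thesis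
    using that[of c] b(1) by (simp add: c_def)
qed

end

text \<open>The form norm of the zero form is the norm, so \<open>hilbert.form_riesz\<close> is the Riesz theorem for
  the whole space.\<close>

interpretation hilbert: closed_nonneg_form "UNIV :: 'a::chilbert_space set" "\<lambda>_ _. 0"
proof
  fix s :: "nat \<Rightarrow> 'a"
  assume "\<forall>e>0. \<exists>N. \<forall>m\<ge>N. \<forall>n\<ge>N. form_norm (\<lambda>_ _. 0) (s m - s n) < e"
  then have "Cauchy s"
    by (simp add: form_norm_def Cauchy_def dist_norm)
  then obtain u where "s \<longlonglongrightarrow> u"
    using Cauchy_convergent convergent_def by blast
  then show "\<exists>u\<in>UNIV. (\<lambda>n. form_norm (\<lambda>_ _. 0) (s n - u)) \<longlonglongrightarrow> 0"
    by (auto simp: form_norm_def LIM_zero_iff tendsto_norm_zero_iff)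
qed (simp_all add: csubspace_UNIV)

lemma cadjoint_exists:
  fixes T :: "'a::chilbert_space \<Rightarrow> 'b::chilbert_space"
  assumes T: "bounded_clinear T"
  shows "bounded_clinear (cadjoint T)" and "cinner (T x) y = cinner x (cadjoint T y)"
proof -
  \<comment> \<open>The pairs are ordered so that the adjoint is \<open>op_inv A\<close>. Bounded
    invertibility of \<open>A\<close> then gives existence, uniqueness and continuity at once, as
    the definite description in \<open>cadjoint\<close> requires.\<close>
  define A where "A = {(u, y). \<forall>x. cinner (T x) y = cinner x u}"
  obtain c where c: "0 < c" "\<And>x. norm (T x) \<le> c * norm x"
    using bounded_clinear_pos_bound[OF T] by blast
  have inv: "boundedly_invertible A"
  proof (rule boundedly_invertible_linear_relation)
    fix y
    have "cmod (cinner (T x) y) \<le> c * norm y * norm x" for x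
    proof -
      have "cmod (cinner (T x) y) \<le> norm (T x) * norm y"
        by (rule cinner_Cauchy_Schwarz)
      also have "\<dots> \<le> c * norm x * norm y"
        using c by (intro mult_right_mono) auto
      finally show ?thesis by (simp add: mult_ac)
    qed
    then obtain w where "\<And>v. cinner v w = cinner (T v) y"
      using hilbert.form_riesz[of "\<lambda>x. cinner (T x) y" "c * norm y"] T
      by (auto simp: bounded_clinear_add bounded_clinear_scaleC cinner_add_left cinner_scaleC_left
        form_norm_def hilbert.ip_def)
    then have "(w, y) \<in> A"
      by (simp add: A_def)
    then show "\<exists>u. (u, y) \<in> A" ..
  next
    fix u y
    assume "(u, y) \<in> A"
    \<comment> \<open>The defining identity is tested with \<open>x = u\<close>.\<close>
    then have "complex_of_real ((norm u)\<^sup>2) = cinner (T u) y"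
      by (simp add: A_def cinner_self)
    then have "(norm u)\<^sup>2 = cmod (cinner (T u) y)"
      by (metis norm_of_real abs_power2)
    also have "\<dots> \<le> norm (T u) * norm y"
      by (rule cinner_Cauchy_Schwarz)
    also have "\<dots> \<le> (c * norm u) * norm y"
      using c by (intro mult_right_mono) auto
    finally show "norm u \<le> c * norm y"
      by (cases "norm u = 0") (use c(1) in \<open>auto simp: power2_eq_square\<close>)
  qed (auto simp: A_def cinner_add_right cinner_scaleC_right)
  have A: "cinner (T x) y = cinner x (op_inv A y)" for x y
    using boundedly_invertibleD(1)[OF inv, of y] by (simp add: A_def)
  have eq: "cadjoint T = op_inv A"
    unfolding cadjoint_def
  proof (rule the_equality)
    fix T' assume "\<forall>x y. cinner (T x) y = cinner x (T' y)"
    then show "T' = op_inv A"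
      using boundedly_invertibleD(2)[OF inv, of "T' y" y for y] by (auto simp: A_def)
  qed (simp add: A)
  show "bounded_clinear (cadjoint T)" "cinner (T x) y = cinner x (cadjoint T y)"
    unfolding eq using A boundedly_invertibleD(3)[OF inv] by auto
qed

text \<open>With \<open>R = (H - z)\<^sup>-\<^sup>1\<close> and \<open>K = (H + 1)\<^sup>-\<^sup>1 = K\<^sup>*\<close>, the adjoint of \<open>R = K + (z + 1) R K\<close> is
  \<open>R\<^sup>* = K (1 + (cnj z + 1) R\<^sup>*)\<close>, which shows that \<open>R\<^sup>*\<close> maps into the domain of \<open>H\<close> and
  inverts \<open>H - cnj z\<close>.\<close>

lemma (in closed_nonneg_form) cnj_notin_spectrum:
  assumes z: "z \<notin> spectrum (form_op D h)"
  shows "cnj z \<notin> spectrum (form_op D h)"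
proof -
  let ?R = "resolvent (form_op D h) z" and ?K = "resolvent (form_op D h) (- 1)"
  note R = resolventD[OF z] and K = resolventD[OF minus_one_notin_spectrum]
  note R' = cadjoint_exists[OF R(4)]
  \<comment> \<open>The first resolvent identity between \<open>z\<close> and \<open>- 1\<close>,
    proved by checking that the right side solves the equation at \<open>z\<close>.\<close>
  have R_eq: "?R f = ?K f + (z + 1) *\<^sub>C ?R (?K f)" for f
  proof (rule R(3))
    fix v assume v: "v \<in> D"
    have "h (?K f + (z + 1) *\<^sub>C ?R (?K f)) v - z * cinner (?K f + (z + 1) *\<^sub>C ?R (?K f)) v
        = h (?K f) v - z * cinner (?K f) v
          + (z + 1) * (h (?R (?K f)) v - z * cinner (?R (?K f)) v)"
      using K(1) R(1) v
      by (simp add: form_add_left form_scaleC_left cinner_add_left cinner_scaleC_left algebra_simps)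
    also have "\<dots> = h (?K f) v - (- 1) * cinner (?K f) v"
      unfolding R(2)[OF v] by (simp add: algebra_simps)
    finally show "h (?K f + (z + 1) *\<^sub>C ?R (?K f)) v - z * cinner (?K f + (z + 1) *\<^sub>C ?R (?K f)) v
        = cinner f v"
      using K(2)[OF v, of f] by simp
  qed (simp add: K(1) R(1))
  have K_sym: "cinner (?K f) g = cinner f (?K g)" for f g
    using K(2)[OF K(1), of f g] K(2)[OF K(1), of g f] cinner_commute[of f]
      shifted_form_commute[OF K(1) K(1), of f g "- 1"] cinner_commute[of g]
    by simp
  have adj_eq: "cadjoint ?R f = ?K (f + (cnj z + 1) *\<^sub>C cadjoint ?R f)" for f
  proof (rule cinner_eqI)
    fix g
    have "cinner (?K (f + (cnj z + 1) *\<^sub>C cadjoint ?R f)) g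
        = cinner f (?K g) + (cnj z + 1) * cinner (cadjoint ?R f) (?K g)"
      by (simp add: K_sym cinner_add_left cinner_scaleC_left)
    also have "\<dots> = cinner f (?R g)"
      using R'(2)[of "?K g" f] R_eq[of g]
      by (simp add: cinner_commute[of "cadjoint ?R f"] cinner_commute[of f]
        cinner_add_left cinner_scaleC_left)
    also have "\<dots> = cinner (cadjoint ?R f) g"
      using R'(2)[of g f] by (simp add: cinner_commute[of "cadjoint ?R f"] cinner_commute[of f])
    finally show "cinner (cadjoint ?R f) g = cinner (?K (f + (cnj z + 1) *\<^sub>C cadjoint ?R f)) g" ..
  qed
  have adj_dom: "cadjoint ?R f \<in> D" for f
    using K(1)[of "f + (cnj z + 1) *\<^sub>C cadjoint ?R f"] adj_eq by simp
  have "boundedly_invertible (form_op D (\<lambda>u v. h u v - cnj z * cinner u v))"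
  proof (rule boundedly_invertibleI[OF R'(1)])
    fix f
    show "(cadjoint ?R f, f) \<in> form_op D (\<lambda>u v. h u v - cnj z * cinner u v)"
      unfolding form_op_iff
    proof (intro conjI ballI)
      fix v assume v: "v \<in> D"
      show "h (cadjoint ?R f) v - cnj z * cinner (cadjoint ?R f) v = cinner f v"
        using K(2)[OF v, of "f + (cnj z + 1) *\<^sub>C cadjoint ?R f"]
        unfolding adj_eq[symmetric] by (simp add: cinner_add_left cinner_scaleC_left algebra_simps)
    qed (rule adj_dom)
  next
    fix u f
    assume "(u, f) \<in> form_op D (\<lambda>u v. h u v - cnj z * cinner u v)"
    then have u: "u \<in> D" "\<And>v. v \<in> D \<Longrightarrow> h u v - cnj z * cinner u v = cinner f v"
      by (auto simp: form_op_iff)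
    have "cinner u g = cinner (cadjoint ?R f) g" for g
    proof -
      \<comment> \<open>The equation for \<open>u\<close> is tested with \<open>?R g\<close>, that
        for \<open>?R g\<close> with \<open>u\<close>; hermitian symmetry makes the left sides
        conjugate.\<close>
      have "cinner u g = cinner f (?R g)"
        using u(2)[OF R(1)] R(2)[OF u(1)] shifted_form_commute[OF u(1) R(1)]
        by (simp add: cinner_commute[of u g])
      then show ?thesis
        using R'(2)[of g f] by (simp add: cinner_commute[of "cadjoint ?R f"] cinner_commute[of f])
    qed
    then show "u = cadjoint ?R f"
      by (rule cinner_eqI)
  qed
  then show ?thesis
    by (simp add: spectrum_def op_shift_form_op)
qed


section \<open>Boundary pairs\<close>

context boundary_pair
begin

lemma bdry_diff: "u \<in> D \<Longrightarrow> v \<in> D \<Longrightarrow> \<Gamma> (u - v) = \<Gamma> u - \<Gamma> v"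
  using bdry_add[of "u - v" v] by simp

lemma bdry_zero: "\<Gamma> 0 = 0"
  using bdry_diff[OF dom_zero dom_zero] by simp

lemma bdry_pos_bound:
  obtains C where "0 \<le> C" "\<And>u. u \<in> D \<Longrightarrow> norm (\<Gamma> u) \<le> C * form_norm h u"
proof -
  obtain C where C: "\<And>u. u \<in> D \<Longrightarrow> norm (\<Gamma> u) \<le> C * form_norm h u"
    using bdry_bounded by blast
  have "norm (\<Gamma> u) \<le> \<bar>C\<bar> * form_norm h u" if "u \<in> D" for u
    using C[OF that] mult_right_mono[OF abs_ge_self form_norm_nonneg[OF that], of C] by linarith
  then show thesis
    using that[of "\<bar>C\<bar>"] by simp
qed

abbreviation "D0 \<equiv> bdry_ker D \<Gamma>"

lemma ker_iff: "u \<in> D0 \<longleftrightarrow> u \<in> D \<and> \<Gamma> u = 0"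
  by (simp add: bdry_ker_def)

text \<open>The kernel is closed in the form domain because the boundary operator is continuous in
  the form norm. All results on closed forms thereby become available for the Dirichlet
  operator.\<close>

sublocale dirichlet: closed_nonneg_form D0 h
proof
  show "csubspace D0"
    by (auto simp: csubspace_def ker_iff bdry_add bdry_scaleC bdry_zero)
  show "closure D0 = UNIV"
    by (rule ker_dense)
next
  fix s :: "nat \<Rightarrow> 'h"
  assume s: "\<And>n. s n \<in> D0"
    and cauchy: "\<forall>e>0. \<exists>N. \<forall>m\<ge>N. \<forall>n\<ge>N. form_norm h (s m - s n) < e"
  then obtain u where u: "u \<in> D" "(\<lambda>n. form_norm h (s n - u)) \<longlonglongrightarrow> 0"
    using form_closed[of s] by (auto simp: ker_iff)
  obtain C where C: "0 \<le> C" "\<And>u. u \<in> D \<Longrightarrow> norm (\<Gamma> u) \<le> C * form_norm h u"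
    using bdry_pos_bound by blast
  have "norm (\<Gamma> u) \<le> C * form_norm h (s n - u)" for n
    using C(2)[of "s n - u"] s[of n] u(1) by (simp add: ker_iff bdry_diff)
  then have "norm (\<Gamma> u) \<le> 0"
    using tendsto_mult_right_zero[OF u(2), of C] by (intro LIMSEQ_le_const) auto
  then show "\<exists>u\<in>D0. (\<lambda>n. form_norm h (s n - u)) \<longlonglongrightarrow> 0"
    using u by (auto simp: ker_iff)
qed (auto simp: ker_iff form_add_left form_scaleC_left form_nonneg intro: form_commute)

section \<open>Weak solutions and the Dirichlet solution operator\<close>

abbreviation "N \<equiv> weak_sol D h \<Gamma>"
abbreviation "S \<equiv> dirichlet_sol D h \<Gamma>"
abbreviation "R\<^sub>D \<equiv> resolvent (form_op D0 h)"
abbreviation "R\<^sub>N \<equiv> resolvent (form_op D h)"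

lemma weak_sol_iff: "u \<in> N z \<longleftrightarrow> u \<in> D \<and> (\<forall>f\<in>D0. h u f = z * cinner u f)"
  by (simp add: weak_sol_def)

lemma weak_sol_add: "u \<in> N z \<Longrightarrow> v \<in> N z \<Longrightarrow> u + v \<in> N z"
  by (auto simp: weak_sol_iff ker_iff form_add_left cinner_add_left distrib_left)

lemma weak_sol_scaleC: "u \<in> N z \<Longrightarrow> a *\<^sub>C u \<in> N z"
  by (auto simp: weak_sol_iff ker_iff form_scaleC_left cinner_scaleC_left)

text \<open>Subtract from \<open>u\<close> its \<open>ip\<close>-orthogonal projection
  \<open>w\<close> onto the kernel: the boundary value is unchanged, and \<open>N (- 1)\<close> is
  exactly the \<open>ip\<close>-orthogonal complement of the kernel.\<close>

lemma weak_sol_minus_one_exists: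
  assumes u: "u \<in> D"
  obtains s where "s \<in> N (- 1)" "\<Gamma> s = \<Gamma> u"
proof -
  have "cmod (ip v u) \<le> form_norm h u * form_norm h v" if "v \<in> D0" for v
    using ip_Cauchy_Schwarz[OF _ u, of v] that by (simp add: ker_iff mult.commute)
  then obtain w where w: "w \<in> D0" "\<And>v. v \<in> D0 \<Longrightarrow> ip v w = ip v u"
    using dirichlet.form_riesz[of "\<lambda>v. ip v u" "form_norm h u"] u
    by (auto simp: ker_iff ip_add_left ip_scaleC_left)
  have "h (u - w) f = - 1 * cinner (u - w) f" if f: "f \<in> D0" for f
  proof -
    have "ip f (u - w) = 0"
      using w f u by (simp add: ker_iff ip_diff_right)
    then have "ip (u - w) f = 0"
      using ip_commute[of "u - w" f] u w(1) f by (simp add: ker_iff)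
    then show ?thesis
      by (simp add: ip_def eq_neg_iff_add_eq_0)
  qed
  then show thesis
    using u w(1) by (intro that[of "u - w"]) (auto simp: weak_sol_iff ker_iff bdry_diff)
qed

context
  fixes z
  assumes z: "z \<notin> spectrum (form_op D0 h)"
begin

lemmas RD = resolventD[OF z]

text \<open>At the point \<open>z\<close>, a solution for \<open>- 1\<close> has the defect
  \<open>- (z + 1) *\<^sub>C s\<close>. The Dirichlet resolvent removes it without touching the
  boundary value.\<close>

lemma weak_sol_shift:
  assumes s: "s \<in> N (- 1)"
  shows "s + (z + 1) *\<^sub>C R\<^sub>D z s \<in> N z" and "\<Gamma> (s + (z + 1) *\<^sub>C R\<^sub>D z s) = \<Gamma> s"
proof -
  have sD: "s \<in> D" and RsD: "R\<^sub>D z s \<in> D" "\<Gamma> (R\<^sub>D z s) = 0"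
    using s RD(1)[of s] by (auto simp: weak_sol_iff ker_iff)
  show "\<Gamma> (s + (z + 1) *\<^sub>C R\<^sub>D z s) = \<Gamma> s"
    using sD RsD by (simp add: bdry_add bdry_scaleC)
  show "s + (z + 1) *\<^sub>C R\<^sub>D z s \<in> N z"
    unfolding weak_sol_iff
  proof (intro conjI ballI)
    fix f assume f: "f \<in> D0"
    then have "f \<in> D" by (simp add: ker_iff)
    have "h (R\<^sub>D z s) f = cinner s f + z * cinner (R\<^sub>D z s) f"
      using RD(2)[OF f, of s] by (simp add: algebra_simps)
    moreover have "h s f = - cinner s f"
      using s f by (simp add: weak_sol_iff)
    ultimately show "h (s + (z + 1) *\<^sub>C R\<^sub>D z s) f = z * cinner (s + (z + 1) *\<^sub>C R\<^sub>D z s) f"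
      using sD RsD \<open>f \<in> D\<close>
      by (simp add: form_add_left form_scaleC_left cinner_add_left cinner_scaleC_left algebra_simps)
  qed (use sD RsD in simp)
qed

text \<open>The difference solves the homogeneous Dirichlet problem, as does 0, so both equal the
  resolvent of 0.\<close>

lemma weak_sol_eqI:
  assumes "u \<in> N z" "v \<in> N z" "\<Gamma> u = \<Gamma> v"
  shows "u = v"
proof -
  have "R\<^sub>D z 0 = u - v"
  proof (rule RD(3))
    show "u - v \<in> D0"
      using assms by (simp add: weak_sol_iff ker_iff bdry_diff)
    show "h (u - v) f - z * cinner (u - v) f = cinner 0 f" if "f \<in> D0" for f
      using assms that
      by (auto simp: weak_sol_iff ker_iff form_diff_left cinner_diff_left algebra_simps)
  qed
  moreover have "R\<^sub>D z 0 = 0"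
    by (rule RD(3)) (auto simp: dirichlet.form_diff_left[of 0 0, simplified])
  ultimately show ?thesis by simp
qed

lemma dirichlet_sol_bdry:
  assumes "u \<in> N z"
  shows "S z (\<Gamma> u) = u"
  unfolding dirichlet_sol_def
  using assms by (intro inv_into_f_f inj_onI weak_sol_eqI) auto

text \<open>Every boundary value is lifted first to \<open>N (- 1)\<close> by projection and then to
  \<open>N z\<close> by the shift.\<close>

lemma dirichlet_sol:
  assumes "\<phi> \<in> \<Gamma> ` D"
  shows "S z \<phi> \<in> N z" and "\<Gamma> (S z \<phi>) = \<phi>"
proof -
  obtain u where u: "u \<in> D" "\<phi> = \<Gamma> u"
    using assms by blast
  obtain s where "s \<in> N (- 1)" "\<Gamma> s = \<Gamma> u"
    using weak_sol_minus_one_exists[OF u(1)] by blast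
  then have "\<phi> \<in> \<Gamma> ` N z"
    using weak_sol_shift[of s] u(2) by (metis image_eqI)
  then show "S z \<phi> \<in> N z" "\<Gamma> (S z \<phi>) = \<phi>"
    unfolding dirichlet_sol_def by (rule inv_into_into, rule f_inv_into_f)
qed

lemma dirichlet_sol_dom: "\<phi> \<in> \<Gamma> ` D \<Longrightarrow> S z \<phi> \<in> D"
  using dirichlet_sol(1) weak_sol_iff by blast

lemma dirichlet_sol_add:
  assumes "\<phi> \<in> \<Gamma> ` D" "\<psi> \<in> \<Gamma> ` D"
  shows "S z (\<phi> + \<psi>) = S z \<phi> + S z \<psi>"
  using dirichlet_sol_bdry[OF weak_sol_add[OF dirichlet_sol(1)[OF assms(1)] dirichlet_sol(1)[OF assms(2)]]]
    assms by (simp add: bdry_add dirichlet_sol_dom dirichlet_sol(2))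

lemma dirichlet_sol_scaleC:
  assumes "\<phi> \<in> \<Gamma> ` D"
  shows "S z (a *\<^sub>C \<phi>) = a *\<^sub>C S z \<phi>"
  using dirichlet_sol_bdry[OF weak_sol_scaleC[OF dirichlet_sol(1)[OF assms]], of a]
    assms by (simp add: bdry_scaleC dirichlet_sol_dom dirichlet_sol(2))

end

text \<open>This carries the elliptic estimate, assumed at \<open>- 1\<close> only, over to
  \<open>z\<close>.\<close>

lemma dirichlet_sol_shift:
  assumes "z \<notin> spectrum (form_op D0 h)" and "\<phi> \<in> \<Gamma> ` D"
  shows "S z \<phi> = S (- 1) \<phi> + (z + 1) *\<^sub>C R\<^sub>D z (S (- 1) \<phi>)"
proof -
  note S1 = dirichlet_sol[OF dirichlet.minus_one_notin_spectrum assms(2)]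
  show ?thesis
    using dirichlet_sol_bdry[OF assms(1) weak_sol_shift(1)[OF assms(1) S1(1)]]
      weak_sol_shift(2)[OF assms(1) S1(1)] S1(2) by simp
qed

section \<open>The boundary range and the Dirichlet-to-Neumann operator\<close>

lemma bdry_range_add: "\<phi> \<in> \<Gamma> ` D \<Longrightarrow> \<psi> \<in> \<Gamma> ` D \<Longrightarrow> \<phi> + \<psi> \<in> \<Gamma> ` D"
  by (auto simp: bdry_add[symmetric])

lemma bdry_range_scaleC: "\<phi> \<in> \<Gamma> ` D \<Longrightarrow> a *\<^sub>C \<phi> \<in> \<Gamma> ` D"
  by (auto simp: bdry_scaleC[symmetric])

lemma bdry_range_csubspace: "csubspace (\<Gamma> ` D)"
proof -
  have "0 \<in> \<Gamma> ` D"
    using bdry_zero dom_zero by (metis image_eqI)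
  then show ?thesis
    unfolding csubspace_def using bdry_range_add bdry_range_scaleC by blast
qed

text \<open>For a weak solution the shifted form depends on its second argument only through the boundary
  value, so the solution operator at \<open>- 1\<close> in \<open>dtn_form\<close> may be replaced by any lift.\<close>

lemma dtn_form_bdry:
  assumes z: "z \<notin> spectrum (form_op D0 h)" and \<phi>: "\<phi> \<in> \<Gamma> ` D" and v: "v \<in> D"
  shows "dtn_form D h \<Gamma> z \<phi> (\<Gamma> v) = h (S z \<phi>) v - z * cinner (S z \<phi>) v"
proof -
  note S1 = dirichlet_sol_dom[OF dirichlet.minus_one_notin_spectrum]
    dirichlet_sol(2)[OF dirichlet.minus_one_notin_spectrum]
  define w where "w = v - S (- 1) (\<Gamma> v)"
  have "w \<in> D0"
    using v S1 by (simp add: w_def ker_iff bdry_diff)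
  then have "h (S z \<phi>) w = z * cinner (S z \<phi>) w"
    using dirichlet_sol(1)[OF z \<phi>] by (simp add: weak_sol_iff)
  then show ?thesis
    using v S1(1) dirichlet_sol_dom[OF z \<phi>]
    by (simp add: w_def dtn_form_def form_diff_right cinner_diff_right algebra_simps)
qed

text \<open>Testing over all of \<open>D\<close> instead of over boundary values turns the operator
  equation into a weak Neumann problem.\<close>

lemma dtn_op_iff:
  assumes "z \<notin> spectrum (form_op D0 h)"
  shows "(\<phi>, \<eta>) \<in> dtn_op D h \<Gamma> z \<longleftrightarrow> \<phi> \<in> \<Gamma> ` D \<and>
    (\<forall>v\<in>D. h (S z \<phi>) v - z * cinner (S z \<phi>) v = cinner \<eta> (\<Gamma> v))"
  using dtn_form_bdry[OF assms] by (auto simp: dtn_op_def form_op_iff)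

text \<open>Test vectors in the kernel annihilate the right-hand side, so \<open>u\<close> is a weak
  solution and coincides with the Dirichlet solution of its own boundary value.\<close>

lemma dtn_opI:
  assumes z: "z \<notin> spectrum (form_op D0 h)" and u: "u \<in> D"
    and eq: "\<And>v. v \<in> D \<Longrightarrow> h u v - z * cinner u v = cinner \<eta> (\<Gamma> v)"
  shows "(\<Gamma> u, \<eta>) \<in> dtn_op D h \<Gamma> z" and "S z (\<Gamma> u) = u"
proof -
  have "u \<in> N z"
    unfolding weak_sol_iff
  proof (intro conjI ballI)
    fix f assume "f \<in> D0"
    then show "h u f = z * cinner u f"
      using eq[of f] by (simp add: ker_iff)
  qed (rule u)
  then show "S z (\<Gamma> u) = u"
    by (rule dirichlet_sol_bdry[OF z])
  then show "(\<Gamma> u, \<eta>) \<in> dtn_op D h \<Gamma> z"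
    using u eq by (simp add: dtn_op_iff[OF z])
qed

lemma dtn_op_boundedly_invertible:
  assumes zD: "z \<notin> spectrum (form_op D0 h)" and zN: "z \<notin> spectrum (form_op D h)"
  shows "boundedly_invertible (dtn_op D h \<Gamma> z)"
proof -
  note R = resolventD[OF zN]
  obtain C where C: "0 \<le> C" "\<And>u. u \<in> D \<Longrightarrow> norm (\<Gamma> u) \<le> C * form_norm h u"
    using bdry_pos_bound by blast
  obtain b where b: "0 \<le> b" "\<And>f. form_norm h (R\<^sub>N z f) \<le> b * norm f"
    using form_norm_resolvent_bound[OF zN] by blast
  \<comment> \<open>The boundary functional is bounded in the form norm, so it is represented by
    some \<open>w\<close>; testing with \<open>w\<close> itself gives the norm bound.\<close>
  have riesz: "\<exists>w\<in>D. (\<forall>v\<in>D. ip w v = cinner \<eta> (\<Gamma> v)) \<and> form_norm h w \<le> C * norm \<eta>" for \<eta>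
  proof -
    have bound: "cmod (cinner (\<Gamma> v) \<eta>) \<le> C * norm \<eta> * form_norm h v" if v: "v \<in> D" for v
      using cinner_Cauchy_Schwarz[of "\<Gamma> v" \<eta>] mult_right_mono[OF C(2)[OF v], of "norm \<eta>"]
      by (simp add: mult_ac)
    then obtain w where w: "w \<in> D" "\<And>v. v \<in> D \<Longrightarrow> ip v w = cinner (\<Gamma> v) \<eta>"
      using form_riesz[of "\<lambda>v. cinner (\<Gamma> v) \<eta>" "C * norm \<eta>"]
      by (auto simp: bdry_add bdry_scaleC cinner_add_left cinner_scaleC_left)
    have "(form_norm h w)\<^sup>2 \<le> C * norm \<eta> * form_norm h w"
      using bound[OF w(1)] w complex_Re_le_cmod[of "ip w w"] by (simp add: form_norm_sq)
    then have "form_norm h w \<le> C * norm \<eta>"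
      using C(1) form_norm_nonneg[OF w(1)]
      by (cases "form_norm h w = 0") (auto simp: power2_eq_square)
    moreover have "ip w v = cinner \<eta> (\<Gamma> v)" if "v \<in> D" for v
      using w that by (simp add: ip_commute[OF w(1) that] cinner_commute[of \<eta>])
    ultimately show ?thesis
      using w(1) by blast
  qed
  show ?thesis
  proof (rule boundedly_invertible_linear_relation)
    fix \<eta>
    obtain w where w: "w \<in> D" "\<And>v. v \<in> D \<Longrightarrow> ip w v = cinner \<eta> (\<Gamma> v)"
      using riesz by blast
    \<comment> \<open>\<open>w\<close> solves the problem at \<open>- 1\<close>; passing to
      \<open>z\<close> leaves the defect \<open>- (z + 1) *\<^sub>C w\<close>, which the Neumann
      resolvent removes.\<close>
    have "(\<Gamma> (w + R\<^sub>N z ((z + 1) *\<^sub>C w)), \<eta>) \<in> dtn_op D h \<Gamma> z"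
    proof (rule dtn_opI(1)[OF zD])
      fix v assume v: "v \<in> D"
      show "h (w + R\<^sub>N z ((z + 1) *\<^sub>C w)) v - z * cinner (w + R\<^sub>N z ((z + 1) *\<^sub>C w)) v
          = cinner \<eta> (\<Gamma> v)"
        using R(2)[OF v, of "(z + 1) *\<^sub>C w"] w(2)[OF v] v w(1) R(1)
        by (simp add: ip_def form_add_left cinner_add_left cinner_scaleC_left algebra_simps)
    qed (simp add: w(1) R(1))
    then show "\<exists>\<phi>. (\<phi>, \<eta>) \<in> dtn_op D h \<Gamma> z" ..
  next
    fix \<phi> \<eta>
    assume "(\<phi>, \<eta>) \<in> dtn_op D h \<Gamma> z"
    then have \<phi>: "\<phi> \<in> \<Gamma> ` D"
      and eq: "\<And>v. v \<in> D \<Longrightarrow> h (S z \<phi>) v - z * cinner (S z \<phi>) v = cinner \<eta> (\<Gamma> v)"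
      by (auto simp: dtn_op_iff[OF zD])
    obtain w where w: "w \<in> D" "\<And>v. v \<in> D \<Longrightarrow> ip w v = cinner \<eta> (\<Gamma> v)"
        "form_norm h w \<le> C * norm \<eta>"
      using riesz by blast
    let ?r = "R\<^sub>N z ((z + 1) *\<^sub>C w)"
    \<comment> \<open>By uniqueness for the Neumann resolvent every solution has the form just
      constructed, so estimating that form bounds the inverse.\<close>
    have "?r = S z \<phi> - w"
    proof (rule R(3))
      fix v assume v: "v \<in> D"
      show "h (S z \<phi> - w) v - z * cinner (S z \<phi> - w) v = cinner ((z + 1) *\<^sub>C w) v"
        using eq[OF v] w(2)[OF v] v w(1) dirichlet_sol_dom[OF zD \<phi>]
        by (simp add: ip_def form_diff_left cinner_diff_left cinner_scaleC_left algebra_simps)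
    qed (simp add: w(1) dirichlet_sol_dom[OF zD \<phi>])
    then have "\<phi> = \<Gamma> w + \<Gamma> ?r"
      using dirichlet_sol(2)[OF zD \<phi>] dirichlet_sol_dom[OF zD \<phi>] w(1) by (simp add: bdry_diff)
    then have "norm \<phi> \<le> norm (\<Gamma> w) + norm (\<Gamma> ?r)"
      using norm_triangle_ineq by metis
    also have "\<dots> \<le> C * form_norm h w + C * (b * (cmod (z + 1) * form_norm h w))"
    proof (intro add_mono)
      show "norm (\<Gamma> w) \<le> C * form_norm h w"
        by (rule C(2)[OF w(1)])
      have "norm (\<Gamma> ?r) \<le> C * form_norm h ?r"
        by (rule C(2)[OF R(1)])
      also have "\<dots> \<le> C * (b * norm ((z + 1) *\<^sub>C w))"
        using b C(1) by (intro mult_left_mono) auto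
      also have "\<dots> \<le> C * (b * (cmod (z + 1) * form_norm h w))"
        unfolding norm_scaleC using b(1) C(1) norm_le_form_norm[OF w(1)]
        by (intro mult_left_mono) auto
      finally show "norm (\<Gamma> ?r) \<le> C * (b * (cmod (z + 1) * form_norm h w))" .
    qed
    also have "\<dots> = (C + C * b * cmod (z + 1)) * form_norm h w"
      by (simp add: algebra_simps)
    also have "\<dots> \<le> (C + C * b * cmod (z + 1)) * (C * norm \<eta>)"
      using w(3) b(1) C(1) by (intro mult_left_mono) auto
    finally show "norm \<phi> \<le> (C + C * b * cmod (z + 1)) * C * norm \<eta>"
      by (simp add: mult.assoc)
  next
    fix \<phi> \<eta> \<psi> \<zeta>
    assume "(\<phi>, \<eta>) \<in> dtn_op D h \<Gamma> z" "(\<psi>, \<zeta>) \<in> dtn_op D h \<Gamma> z"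
    then show "(\<phi> + \<psi>, \<eta> + \<zeta>) \<in> dtn_op D h \<Gamma> z"
      using dirichlet_sol_dom[OF zD]
      by (simp add: dtn_op_iff[OF zD] bdry_range_add dirichlet_sol_add[OF zD] form_add_left
        cinner_add_left algebra_simps)
  next
    fix a \<phi> \<eta>
    assume A: "(\<phi>, \<eta>) \<in> dtn_op D h \<Gamma> z"
    have "a * h (S z \<phi>) v - z * (a * cinner (S z \<phi>) v) = a * cinner \<eta> (\<Gamma> v)" if "v \<in> D" for v
    proof -
      have eq: "h (S z \<phi>) v - z * cinner (S z \<phi>) v = cinner \<eta> (\<Gamma> v)"
        using A that by (simp add: dtn_op_iff[OF zD])
      show ?thesis
        unfolding eq[symmetric] by (simp add: algebra_simps)
    qed
    then show "(a *\<^sub>C \<phi>, a *\<^sub>C \<eta>) \<in> dtn_op D h \<Gamma> z"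
      using A dirichlet_sol_dom[OF zD]
      by (simp add: dtn_op_iff[OF zD] bdry_range_scaleC dirichlet_sol_scaleC[OF zD]
        form_scaleC_left cinner_scaleC_left)
  qed
qed

end

section \<open>Extended solution operators and the resolvent formula\<close>

context elliptically_regular_boundary_pair
begin

abbreviation "S_ext \<equiv> dirichlet_sol_ext D h \<Gamma>"

lemma dirichlet_sol_ext:
  assumes z: "z \<notin> spectrum (form_op D0 h)"
  shows "bounded_clinear (S_ext z)" and "\<phi> \<in> \<Gamma> ` D \<Longrightarrow> S_ext z \<phi> = S z \<phi>"
proof -
  obtain c where c: "0 < c" "\<And>\<phi>. \<phi> \<in> \<Gamma> ` D \<Longrightarrow> norm (S (- 1) \<phi>) \<le> c * norm \<phi>"
    using elliptic_regularity by blast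
  obtain b where b: "0 < b" "\<And>f. norm (R\<^sub>D z f) \<le> b * norm f"
    using bounded_clinear_pos_bound[OF resolventD(4)[OF z]] by blast
  \<comment> \<open>The elliptic constant \<open>c\<close> at \<open>- 1\<close> is multiplied by
    the norm bound of the shift from \<open>- 1\<close> to \<open>z\<close>.\<close>
  have bound: "norm (S z \<phi>) \<le> (1 + cmod (z + 1) * b) * c * norm \<phi>" if \<phi>: "\<phi> \<in> \<Gamma> ` D" for \<phi>
  proof -
    have "norm (S z \<phi>) \<le> norm (S (- 1) \<phi>) + cmod (z + 1) * norm (R\<^sub>D z (S (- 1) \<phi>))"
      using norm_triangle_ineq[of "S (- 1) \<phi>" "(z + 1) *\<^sub>C R\<^sub>D z (S (- 1) \<phi>)"]
      by (simp add: dirichlet_sol_shift[OF z \<phi>] norm_scaleC)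
    also have "\<dots> \<le> norm (S (- 1) \<phi>) + cmod (z + 1) * (b * norm (S (- 1) \<phi>))"
      using b by (intro add_left_mono mult_left_mono) auto
    also have "\<dots> = (1 + cmod (z + 1) * b) * norm (S (- 1) \<phi>)"
      by (simp add: algebra_simps)
    also have "\<dots> \<le> (1 + cmod (z + 1) * b) * (c * norm \<phi>)"
      using b(1) c(2)[OF \<phi>] by (intro mult_left_mono) auto
    finally show ?thesis by (simp add: mult.assoc)
  qed
  have "\<exists>!T. bounded_clinear T \<and> (\<forall>\<phi>\<in>\<Gamma> ` D. T \<phi> = S z \<phi>)"
    by (rule bounded_clinear_extension[OF bdry_range_csubspace ran_dense
        dirichlet_sol_add[OF z] dirichlet_sol_scaleC[OF z] bound])
  from theI'[OF this] show "bounded_clinear (S_ext z)" "\<phi> \<in> \<Gamma> ` D \<Longrightarrow> S_ext z \<phi> = S z \<phi>"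
    unfolding dirichlet_sol_ext_def by auto
qed

text \<open>The boundary term in Green's formula for \<open>u = (H\<^sup>D - z)\<^sup>-\<^sup>1 f\<close>: the adjoint of the
  solution operator plays the role of minus the normal derivative of \<open>u\<close>.\<close>

lemma dirichlet_resolvent_green:
  assumes z: "z \<notin> spectrum (form_op D0 h)" and v: "v \<in> D"
  shows "h (R\<^sub>D z f) v - z * cinner (R\<^sub>D z f) v
    = cinner f v - cinner (cadjoint (S_ext (cnj z)) f) (\<Gamma> v)"
proof -
  note z' = dirichlet.cnj_notin_spectrum[OF z] and R = resolventD[OF z]
  \<comment> \<open>Since \<open>s\<close> has the boundary value of \<open>v\<close>, the
    difference \<open>v - s\<close> is an admissible test vector for the Dirichlet equation.\<close>
  define s where "s = S (cnj z) (\<Gamma> v)"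
  have s: "s \<in> N (cnj z)" "\<Gamma> s = \<Gamma> v" "S_ext (cnj z) (\<Gamma> v) = s"
    using dirichlet_sol[OF z'] dirichlet_sol_ext(2)[OF z'] v by (auto simp: s_def)
  then have sD: "s \<in> D" and vs: "v - s \<in> D0"
    using v by (auto simp: weak_sol_iff ker_iff bdry_diff)
  have RD0: "R\<^sub>D z f \<in> D0" and RD: "R\<^sub>D z f \<in> D"
    using R(1)[of f] by (auto simp: ker_iff)
  \<comment> \<open>Symmetry moves \<open>z\<close> to \<open>cnj z\<close>, where \<open>s\<close>
    is a weak solution and the Dirichlet resolvent is an admissible test vector.\<close>
  have "h (R\<^sub>D z f) s - z * cinner (R\<^sub>D z f) s = cnj (h s (R\<^sub>D z f) - cnj z * cinner s (R\<^sub>D z f))"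
    by (rule shifted_form_commute[OF RD sD])
  also have "\<dots> = 0"
    using s(1) RD0 by (simp add: weak_sol_iff)
  finally have "h (R\<^sub>D z f) v - z * cinner (R\<^sub>D z f) v = cinner f (v - s)"
    using R(2)[OF vs, of f] RD sD v
    by (simp add: form_diff_right cinner_diff_right algebra_simps)
  moreover have "cinner f s = cinner (cadjoint (S_ext (cnj z)) f) (\<Gamma> v)"
    using cadjoint_exists(2)[OF dirichlet_sol_ext(1)[OF z'], of "\<Gamma> v" f] s(3)
    by (simp add: cinner_commute[of f] cinner_commute[of "cadjoint (S_ext (cnj z)) f"])
  ultimately show ?thesis
    by (simp add: cinner_diff_right)
qed

text \<open>Membership of \<open>z\<close> in the Neumann resolvent set is a conclusion: the
  right-hand side \<open>T\<close> is shown to be a bounded inverse of \<open>H - z\<close>, which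
  yields the formula as well. This is the converse half of the spectral equivalence.\<close>

lemma krein_formula:
  assumes z: "z \<notin> spectrum (form_op D0 h)"
    and inv: "boundedly_invertible (dtn_op D h \<Gamma> z)"
  shows "z \<notin> spectrum (form_op D h)"
    and "R\<^sub>N z f = R\<^sub>D z f + S_ext z (op_inv (dtn_op D h \<Gamma> z) (cadjoint (S_ext (cnj z)) f))"
proof -
  note z' = dirichlet.cnj_notin_spectrum[OF z] and R = resolventD[OF z]
  note L = boundedly_invertibleD[OF inv]
  define A where "A = cadjoint (S_ext (cnj z))"
  define T where "T f = R\<^sub>D z f + S_ext z (op_inv (dtn_op D h \<Gamma> z) (A f))" for f
  have "bounded_clinear A"
    unfolding A_def by (rule cadjoint_exists(1)[OF dirichlet_sol_ext(1)[OF z']])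
  then have bounded: "bounded_clinear T"
    unfolding T_def[abs_def]
    by (intro bounded_clinear_fun_add bounded_clinear_compose[OF dirichlet_sol_ext(1)[OF z]]
        bounded_clinear_compose[OF L(3)] R(4))
  have T: "(T f, f) \<in> form_op D (\<lambda>u v. h u v - z * cinner u v)" for f
    unfolding form_op_iff
  proof (intro conjI ballI)
    define \<phi> where "\<phi> = op_inv (dtn_op D h \<Gamma> z) (A f)"
    have \<phi>: "\<phi> \<in> \<Gamma> ` D"
      and eq: "\<And>v. v \<in> D \<Longrightarrow> h (S z \<phi>) v - z * cinner (S z \<phi>) v = cinner (A f) (\<Gamma> v)"
      using L(1)[of "A f"] by (auto simp: \<phi>_def dtn_op_iff[OF z])
    have T_eq: "T f = R\<^sub>D z f + S z \<phi>"
      using dirichlet_sol_ext(2)[OF z \<phi>] by (simp add: T_def \<phi>_def)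
    have RD: "R\<^sub>D z f \<in> D" and SD: "S z \<phi> \<in> D"
      using R(1)[of f] dirichlet_sol_dom[OF z \<phi>] by (auto simp: ker_iff)
    then show "T f \<in> D"
      by (simp add: T_eq)
    fix v assume v: "v \<in> D"
    \<comment> \<open>The solution part contributes \<open>cinner (A f) (\<Gamma> v)\<close>, which
      cancels the boundary term in Green's formula.\<close>
    have "h (T f) v - z * cinner (T f) v = h (R\<^sub>D z f) v - z * cinner (R\<^sub>D z f) v
        + (h (S z \<phi>) v - z * cinner (S z \<phi>) v)"
      using RD SD v by (simp add: T_eq form_add_left cinner_add_left algebra_simps)
    also have "\<dots> = cinner f v"
      unfolding dirichlet_resolvent_green[OF z v] eq[OF v] A_def[symmetric] by simp
    finally show "h (T f) v - z * cinner (T f) v = cinner f v" .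
  qed
  \<comment> \<open>The boundary value of a homogeneous Neumann solution is annihilated by the
    Dirichlet-to-Neumann operator, hence is zero; the solution operator then recovers
    \<open>u = 0\<close>.\<close>
  have kernel: "u = 0" if "u \<in> D" "\<And>v. v \<in> D \<Longrightarrow> h u v - z * cinner u v = 0" for u
  proof -
    have "(\<Gamma> u, 0) \<in> dtn_op D h \<Gamma> z" and u: "S z (\<Gamma> u) = u"
      using dtn_opI[OF z that(1), of 0] that(2) by auto
    moreover have "(\<Gamma> 0, 0) \<in> dtn_op D h \<Gamma> z" and 0: "S z (\<Gamma> 0) = 0"
      using dtn_opI[OF z dom_zero, of 0] form_diff_left[OF dom_zero dom_zero] by auto
    ultimately have "\<Gamma> u = \<Gamma> 0"
      using L(2) by metis
    then show "u = 0"
      using u 0 by simp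
  qed
  have unique: "u = T f" if "(u, f) \<in> form_op D (\<lambda>u v. h u v - z * cinner u v)" for u f
  proof -
    have "u - T f = 0"
    proof (rule kernel)
      fix v assume v: "v \<in> D"
      show "h (u - T f) v - z * cinner (u - T f) v = 0"
        using that T[of f] v by (auto simp: form_op_iff form_diff_left cinner_diff_left algebra_simps)
    qed (use that T[of f] in \<open>auto simp: form_op_iff\<close>)
    then show ?thesis by simp
  qed
  note res = boundedly_invertibleI[OF bounded T unique]
  show "z \<notin> spectrum (form_op D h)"
    using res(1) by (simp add: spectrum_def op_shift_form_op)
  show "R\<^sub>N z f = R\<^sub>D z f + S_ext z (op_inv (dtn_op D h \<Gamma> z) (cadjoint (S_ext (cnj z)) f))"
    using res(2) by (simp add: resolvent_def op_shift_form_op T_def A_def)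
qed

end

section \<open>Resolvent difference and spectral equivalence\<close>

theorem theorem1p5:
  fixes D :: "'h::chilbert_space set"
    and h :: "'h \<Rightarrow> 'h \<Rightarrow> complex"
    and \<Gamma> :: "'h \<Rightarrow> 'g::chilbert_space"
  assumes "elliptically_regular_boundary_pair D h \<Gamma>"
  shows "(\<forall>z. z \<notin> spectrum (dirichlet_op D h \<Gamma>) \<union> spectrum (neumann_op D h) \<longrightarrow>
      boundedly_invertible (dtn_op D h \<Gamma> z) \<and>
      bounded_clinear (\<lambda>f. resolvent (neumann_op D h) z f - resolvent (dirichlet_op D h \<Gamma>) z f) \<and>
      (\<lambda>f. resolvent (neumann_op D h) z f - resolvent (dirichlet_op D h \<Gamma>) z f) =
        dirichlet_sol_ext D h \<Gamma> z \<circ> op_inv (dtn_op D h \<Gamma> z)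
          \<circ> cadjoint (dirichlet_sol_ext D h \<Gamma> (cnj z))) \<and>
    (\<forall>\<mu>. \<mu> \<notin> spectrum (dirichlet_op D h \<Gamma>) \<longrightarrow>
      (\<mu> \<in> spectrum (neumann_op D h) \<longleftrightarrow> 0 \<in> spectrum (dtn_op D h \<Gamma> \<mu>)))"
proof -
  interpret elliptically_regular_boundary_pair D h \<Gamma>
    by (rule assms)
  show ?thesis
    unfolding dirichlet_op_def neumann_op_def
  proof (intro conjI allI impI)
    fix z
    assume "z \<notin> spectrum (form_op D0 h) \<union> spectrum (form_op D h)"
    then have zD: "z \<notin> spectrum (form_op D0 h)" and zN: "z \<notin> spectrum (form_op D h)"
      by auto
    show inv: "boundedly_invertible (dtn_op D h \<Gamma> z)"
      by (rule dtn_op_boundedly_invertible[OF zD zN])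
    show "bounded_clinear (\<lambda>f. R\<^sub>N z f - R\<^sub>D z f)"
      by (rule bounded_clinear_fun_diff[OF resolventD(4)[OF zN] resolventD(4)[OF zD]])
    show "(\<lambda>f. R\<^sub>N z f - R\<^sub>D z f)
        = S_ext z \<circ> op_inv (dtn_op D h \<Gamma> z) \<circ> cadjoint (S_ext (cnj z))"
      by (simp add: krein_formula(2)[OF zD inv] fun_eq_iff)
  next
    fix \<mu>
    assume "\<mu> \<notin> spectrum (form_op D0 h)"
    \<comment> \<open>Shifting by 0 changes nothing, so 0 lies in the spectrum exactly when
      \<open>dtn_op\<close> has no bounded inverse; the two lemmas give the contrapositives.\<close>
    then show "\<mu> \<in> spectrum (form_op D h) \<longleftrightarrow> 0 \<in> spectrum (dtn_op D h \<Gamma> \<mu>)"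
      using dtn_op_boundedly_invertible krein_formula(1) by (auto simp: spectrum_def[of "dtn_op D h \<Gamma> \<mu>"])
  qed
qed

end
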